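(* Set $\bar X^m=(\bar X_{t_0},\dots,\bar X_{t_m})$ and $Y^m=(Y_{t_0},\dots,Y_{t_m})$. Then, almost surely, $$\mathbb P\big(\tau^{\bar X}_{\mathbf a}>t_n\,\big|\,Y_{t_0},\dots,Y_{t_m}\big)=\Psi(Y_{t_0},\dots,Y_{t_m}),$$ where for $y^m=(y_0,\dots,y_m)$, $$\Psi(y^m)=\mathbb E\big[\Phi(\bar X^m)\,\big|\,Y^m=y^m\big],$$ and the function $\Phi$ is defined for every $z^m=(z_0,\dots,z_m)$ by $$\Phi(z^m)=\bar F(t_m,t_n,z_m)\prod_{k=0}^{m-1}G_k(z_k,z_{k+1}),$$ with $$\bar F(t_m,t_n,x)=\mathbb E\Big[\prod_{k=m}^{n-1}G_k(\bar X_{t_k},\bar X_{t_{k+1}})\,\Big|\,\bar X_{t_m}=x\Big].$$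
   Context: Let $W$ and $\widetilde W$ be two independent standard real-valued Brownian motions. The functions $b(x,t),\sigma(x,t),h(y,x,t),\nu(y,t),\delta(y,t)$ are real-valued and Lipschitz, and $\sigma(x,t)>0$, $\nu(x,t)>0$, $\delta(x,t)>0$ for every $x>0$, $t\ge 0$. Let $x_0,y_0\in\mathbb R$ be deterministic and let $\mathbf a$ be a real number with $0<\mathbf a<x_0$. Time grid: let $0<s<t$ and integers $1\le m<n$; set $t_k=\frac{ks}{m}$ for $k=0,\dots,m$ and $t_k=s+\frac{(k-m)(t-s)}{n-m}$ for $k=m+1,\dots,n$, so that $0=t_0<\dots<t_m=s<t_{m+1}<\dots<t_n=t$. Set $\Delta_k=t_{k+1}-t_k$. The continuous Euler scheme $(\bar X_u)_{u\in[0,t]}$ is defined by $\bar X_0=x_0$ and $$\bar X_u=\bar X_{\underline u}+b(\bar X_{\underline u},\underline u)(u-\underline u)+\sigma(\bar X_{\underline u},\underline u)(W_u-W_{\underline u}),\qquad \underline u=t_k\ \text{ if } u\in[t_k,t_{k+1})$$ (extended to $u=t_n$ by continuity). The discrete-time observations are defined by $Y_{t_0}=y_0$ and, for $k=0,\dots,m-1$, $$Y_{t_{k+1}}=Y_{t_k}+h(Y_{t_k},\bar X_{t_k},t_k)\Delta_k+\nu(Y_{t_k},t_k)(W_{t_{k+1}}-W_{t_k})+\delta(Y_{t_k},t_k)(\widetilde W_{t_{k+1}}-\widetilde W_{t_k}).$$ The hitting time is $\tau^{\bar X}_{\mathbf a}=\inf\{u\ge 0:\ \bar X_u\le\mathbf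 a\}$, with $\inf\emptyset=+\infty$ (only $u\in[0,t]$ is relevant here). For $k=0,\dots,n-1$ and $x,x'\in\mathbb R$, $$G_k(x,x')=\Big(1-\exp\Big(-\frac{2(x-\mathbf a)(x'-\mathbf a)}{\Delta_k\,\sigma^2(x,t_k)}\Big)\Big)\mathbf 1_{\{x\ge\mathbf a,\ x'\ge\mathbf a\}},$$ understood as $0$ when $x<\mathbf a$ or $x'<\mathbf a$ (the paper writes $G^{x,x'}_{\Delta_k\sigma_k^2}(\mathbf a)$ with $\sigma_k=\sigma(x,t_k)$). *)

theory Defs
  imports "HOL-Probability.Probability"
begin

subsection \<open>Brownian motion\<close>

definition brownian_motion :: "'a measure \<Rightarrow> (real \<Rightarrow> 'a \<Rightarrow> real) \<Rightarrow> bool" where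
  "brownian_motion M W \<longleftrightarrow>
     prob_space M \<and>
     (\<forall>u\<ge>0. W u \<in> borel_measurable M) \<and>
     (AE \<omega> in M. W 0 \<omega> = 0) \<and>
     (\<forall>u v. 0 \<le> u \<and> u < v \<longrightarrow>
        distributed M lborel (\<lambda>\<omega>. W v \<omega> - W u \<omega>) (normal_density 0 (sqrt (v - u)))) \<and>
     (\<forall>(N::nat) r. 0 \<le> r 0 \<and> (\<forall>i<N. r i \<le> r (Suc i)) \<longrightarrow>
        prob_space.indep_vars M (\<lambda>_. borel) (\<lambda>i \<omega>. W (r (Suc i)) \<omega> - W (r i) \<omega>) {..<N}) \<and>
     (\<forall>\<omega>\<in>space M. continuous_on {0..} (\<lambda>u. W u \<omega>))"

text \<open>Independence of the processes on \<open>{0..}\<close>, i.e. of the \<open>\<sigma>\<close>-algebras they generate.\<close>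

definition indep_processes ::
  "'a measure \<Rightarrow> (real \<Rightarrow> 'a \<Rightarrow> real) \<Rightarrow> (real \<Rightarrow> 'a \<Rightarrow> real) \<Rightarrow> bool" where
  "indep_processes M V W \<longleftrightarrow>
     prob_space.indep_var M
       (PiM {0..} (\<lambda>_. borel)) (\<lambda>\<omega>. \<lambda>u\<in>{0..}. V u \<omega>)
       (PiM {0..} (\<lambda>_. borel)) (\<lambda>\<omega>. \<lambda>u\<in>{0..}. W u \<omega>)"

subsection \<open>Conditioning on a random variable\<close>

definition sigma_gen :: "'a measure \<Rightarrow> 'b measure \<Rightarrow> ('a \<Rightarrow> 'b) \<Rightarrow> 'a measure" where
  "sigma_gen M N Z = vimage_algebra (space M) Z N"

text \<open>\<open>g\<close> is a version of the function \<open>z \<mapsto> E[f | Z = z]\<close>, which is determined only up to null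
  sets of the law of \<open>Z\<close>: \<open>g\<close> is measurable and \<open>g(Z) = E[f | \<sigma>(Z)]\<close> almost surely.\<close>

definition cond_exp_version ::
  "'a measure \<Rightarrow> 'b measure \<Rightarrow> ('a \<Rightarrow> 'b) \<Rightarrow> ('a \<Rightarrow> real) \<Rightarrow> ('b \<Rightarrow> real) \<Rightarrow> bool" where
  "cond_exp_version M N Z f g \<longleftrightarrow>
     g \<in> borel_measurable N \<and>
     (AE \<omega> in M. g (Z \<omega>) = real_cond_exp M (sigma_gen M N Z) f \<omega>)"

lemma factor_through_vimage_algebra:
  fixes u :: "'a \<Rightarrow> ennreal"
  assumes Z: "Z \<in> X \<rightarrow> space N" and "u \<in> borel_measurable (vimage_algebra X Z N)"
  shows "\<exists>g\<in>borel_measurable N. \<forall>x\<in>X. u x = g (Z x)"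
  using assms(2)
proof (induction u rule: borel_measurable_induct)
  case (cong f g)
  then show ?case by (metis space_vimage_algebra)
next
  case (set A)
  then obtain B where "B \<in> sets N" "A = Z -` B \<inter> X"
    using Z by (auto simp: sets_vimage_algebra2)
  then show ?case
    by (intro bexI[of _ "indicator B"]) (auto simp: indicator_def)
next
  case (mult u c)
  then obtain g where "g \<in> borel_measurable N" "\<forall>x\<in>X. u x = g (Z x)" by blast
  then show ?case by (intro bexI[of _ "\<lambda>z. c * g z"]) auto
next
  case (add u v)
  then obtain g h where "g \<in> borel_measurable N" "\<forall>x\<in>X. u x = g (Z x)"
    "h \<in> borel_measurable N" "\<forall>x\<in>X. v x = h (Z x)" by blast
  then show ?case by (intro bexI[of _ "\<lambda>z. h z + g z"]) auto
next
  case (seq U)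
  then have "\<forall>i. \<exists>g. g \<in> borel_measurable N \<and> (\<forall>x\<in>X. U i x = g (Z x))" by blast
  then obtain g where "\<And>i. g i \<in> borel_measurable N" "\<And>i x. x \<in> X \<Longrightarrow> U i x = g i (Z x)"
    by metis
  then show ?case
    by (intro bexI[of _ "\<lambda>z. SUP i. g i z"]) (auto simp: image_image)
qed

lemma cond_exp_version_exists:
  assumes "Z \<in> measurable M N"
  shows "\<exists>g. cond_exp_version M N Z f g"
proof -
  let ?F = "sigma_gen M N Z"
  have Z: "Z \<in> space M \<rightarrow> space N"
    using measurable_space[OF assms] by auto
  have "nn_cond_exp M ?F u \<in> borel_measurable (vimage_algebra (space M) Z N)" for u
    using borel_measurable_nn_cond_exp[of M ?F u] by (simp add: sigma_gen_def)
  note fac = factor_through_vimage_algebra[OF Z this]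
  obtain p where p: "p \<in> borel_measurable N"
      "\<forall>x\<in>space M. nn_cond_exp M ?F (\<lambda>x. ennreal (f x)) x = p (Z x)"
    using fac by blast
  obtain q where q: "q \<in> borel_measurable N"
      "\<forall>x\<in>space M. nn_cond_exp M ?F (\<lambda>x. ennreal (- f x)) x = q (Z x)"
    using fac by blast
  have "cond_exp_version M N Z f (\<lambda>z. enn2real (p z) - enn2real (q z))"
    unfolding cond_exp_version_def real_cond_exp_def using p q by (auto intro!: AE_I2)
  then show ?thesis by blast
qed

subsection \<open>Time grid, Euler scheme and observations\<close>

definition grid :: "real \<Rightarrow> real \<Rightarrow> nat \<Rightarrow> nat \<Rightarrow> nat \<Rightarrow> real" where
  "grid s t m n k =
     (if k \<le> m then real k * s / real m
      else s + real (k - m) * (t - s) / real (n - m))"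

primrec euler_node ::
  "(real \<Rightarrow> real \<Rightarrow> real) \<Rightarrow> (real \<Rightarrow> real \<Rightarrow> real) \<Rightarrow> real \<Rightarrow> (nat \<Rightarrow> real) \<Rightarrow>
   (real \<Rightarrow> real) \<Rightarrow> nat \<Rightarrow> real" where
  "euler_node b \<sigma> x0 T w 0 = x0"
| "euler_node b \<sigma> x0 T w (Suc k) =
     euler_node b \<sigma> x0 T w k
     + b (euler_node b \<sigma> x0 T w k) (T k) * (T (Suc k) - T k)
     + \<sigma> (euler_node b \<sigma> x0 T w k) (T k) * (w (T (Suc k)) - w (T k))"

text \<open>The scheme driven by the process \<open>W\<close>, on the interval from \<open>T 0\<close> to \<open>T n\<close>. The left
  neighbour of \<open>u\<close> is sought among \<open>T 0, \<dots>, T (n - 1)\<close> only, which at \<open>u = T n\<close> gives the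
  extension by continuity.\<close>

definition euler ::
  "(real \<Rightarrow> real \<Rightarrow> real) \<Rightarrow> (real \<Rightarrow> real \<Rightarrow> real) \<Rightarrow> real \<Rightarrow> (nat \<Rightarrow> real) \<Rightarrow> nat \<Rightarrow>
   (real \<Rightarrow> 'a \<Rightarrow> real) \<Rightarrow> real \<Rightarrow> 'a \<Rightarrow> real" where
  "euler b \<sigma> x0 T n W u \<omega> =
     (let k = Max {k. k < n \<and> T k \<le> u};
          x = euler_node b \<sigma> x0 T (\<lambda>v. W v \<omega>) k
      in x + b x (T k) * (u - T k) + \<sigma> x (T k) * (W u \<omega> - W (T k) \<omega>))"

primrec observation ::
  "(real \<Rightarrow> real \<Rightarrow> real \<Rightarrow> real) \<Rightarrow> (real \<Rightarrow> real \<Rightarrow> real) \<Rightarrow> (real \<Rightarrow> real \<Rightarrow> real) \<Rightarrow> real \<Rightarrow>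
   (nat \<Rightarrow> real) \<Rightarrow> (real \<Rightarrow> 'a \<Rightarrow> real) \<Rightarrow> (real \<Rightarrow> 'a \<Rightarrow> real) \<Rightarrow> (real \<Rightarrow> 'a \<Rightarrow> real) \<Rightarrow>
   nat \<Rightarrow> 'a \<Rightarrow> real" where
  "observation h \<nu> \<delta> y0 T X W W' 0 \<omega> = y0"
| "observation h \<nu> \<delta> y0 T X W W' (Suc k) \<omega> =
     (let y = observation h \<nu> \<delta> y0 T X W W' k \<omega>
      in y + h y (X (T k) \<omega>) (T k) * (T (Suc k) - T k)
           + \<nu> y (T k) * (W (T (Suc k)) \<omega> - W (T k) \<omega>)
           + \<delta> y (T k) * (W' (T (Suc k)) \<omega> - W' (T k) \<omega>))"

lemma euler_at_0:
  assumes "strict_mono_on {..n} T" and "0 < n"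
  shows "euler b \<sigma> x0 T n W (T 0) \<omega> = x0"
proof -
  have "{k. k < n \<and> T k \<le> T 0} = {0}"
    using assms by (auto simp: strict_mono_on_leD strict_mono_on_less_eq)
  then show ?thesis by (simp add: euler_def)
qed

lemma euler_step:
  assumes mono: "strict_mono_on {..n} T" and k: "k < n" and u: "T k \<le> u" "u \<le> T (Suc k)"
  shows "euler b \<sigma> x0 T n W u \<omega> =
    euler b \<sigma> x0 T n W (T k) \<omega>
    + b (euler b \<sigma> x0 T n W (T k) \<omega>) (T k) * (u - T k)
    + \<sigma> (euler b \<sigma> x0 T n W (T k) \<omega>) (T k) * (W u \<omega> - W (T k) \<omega>)"
proof -
  have Max: "Max {j. j < n \<and> T j \<le> v} = i"
    if "i < n" "T i \<le> v" "v < T (Suc i)" for i v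
  proof (rule Max_eqI)
    fix j assume "j \<in> {j. j < n \<and> T j \<le> v}"
    then have j: "j < n" "T j < T (Suc i)" using that by auto
    then have "j < Suc i"
      using strict_mono_on_less[OF mono, of j "Suc i"] that by auto
    then show "j \<le> i" by simp
  qed (use that in auto)
  have node: "euler b \<sigma> x0 T n W (T i) \<omega> = euler_node b \<sigma> x0 T (\<lambda>v. W v \<omega>) i" if "i < n" for i
    using Max[of i "T i"] that strict_mono_on_less[OF mono, of i "Suc i"]
    by (simp add: euler_def)
  consider "u < T (Suc k)" | "u = T (Suc k)" "Suc k < n" | "u = T (Suc k)" "Suc k = n"
    using u k by linarith
  then show ?thesis
  proof cases
    case 1
    then show ?thesis using Max[OF k u(1)] node[OF k] by (simp add: euler_def Let_def)
  next
    case 2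
    then show ?thesis using node[OF k] node[of "Suc k"] by simp
  next
    case 3
    have "Max {j. j < n \<and> T j \<le> u} = k"
      using 3 u by (intro Max_eqI) auto
    then show ?thesis using node[OF k] by (simp add: euler_def Let_def)
  qed
qed

lemma strict_mono_on_grid:
  assumes "0 < s" "s < t" "1 \<le> m" "m < n"
  shows "strict_mono_on {..n} (grid s t m n)"
proof (rule strict_mono_onI)
  fix i j :: nat assume "i \<in> {..n}" "j \<in> {..n}" and ij: "i < j"
  consider "j \<le> m" | "m < i" | "i \<le> m" "m < j" by linarith
  then show "grid s t m n i < grid s t m n j"
  proof cases
    case 1
    then show ?thesis using assms ij by (simp add: grid_def divide_strict_right_mono)
  next
    case 2
    then show ?thesis using assms ij
      by (simp add: grid_def divide_strict_right_mono)
  next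
    case 3
    have "real i * s / real m \<le> s" using assms 3 by (simp add: field_simps)
    moreover have "0 < real (j - m) * (t - s) / real (n - m)" using assms 3 by simp
    ultimately show ?thesis using 3 by (simp add: grid_def)
  qed
qed

subsection \<open>Hitting time and survival factors\<close>

text \<open>\<open>Inf {} = \<infinity>\<close> in \<^typ>\<open>ereal\<close>; \<open>X\<close> is a process on \<open>{0..t}\<close>.\<close>

definition hitting_time :: "real \<Rightarrow> real \<Rightarrow> (real \<Rightarrow> 'a \<Rightarrow> real) \<Rightarrow> 'a \<Rightarrow> ereal" where
  "hitting_time t a X \<omega> = Inf (ereal ` {u \<in> {0..t}. X u \<omega> \<le> a})"

definition survival_factor ::
  "real \<Rightarrow> (real \<Rightarrow> real \<Rightarrow> real) \<Rightarrow> (nat \<Rightarrow> real) \<Rightarrow> nat \<Rightarrow> real \<Rightarrow> real \<Rightarrow> real" where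
  "survival_factor a \<sigma> T k x x' =
     (if x \<ge> a \<and> x' \<ge> a
      then 1 - exp (- (2 * (x - a) * (x' - a) / ((T (Suc k) - T k) * (\<sigma> x (T k))\<^sup>2)))
      else 0)"

end

theory Submission
  imports Defs
begin

text \<open>
Survival up to \<open>t_n\<close> means that the scheme stays above \<open>a\<close> on each of the \<open>n\<close> intervals of the
grid. On \<open>{t_k..t_{k+1}}\<close> the scheme is a Brownian motion with constant drift and constant
volatility, started at its value at \<open>t_k\<close>. Given its two end values such a piece is a scaled
Brownian bridge, whatever the drift, and it stays above \<open>a\<close> with probability \<open>G_k\<close>
(\<open>brownian_bridge_survival\<close>).

The pieces of \<open>W\<close> over the intervals are independent of each other and of \<open>W'\<close>
(\<open>indep_path_samples\<close>), and both the grid values of the scheme and the observations depend on a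
piece only through its end increment. Inside an expectation against an event of the observations,
each survival indicator can therefore be replaced by its factor \<open>G_k\<close>, one interval at a time
(\<open>replace_survival\<close>, \<open>replace_all_survival\<close>).

The factors with \<open>k < m\<close> are functions of the states up to \<open>t_m\<close>. The others depend on the past only
through the state at \<open>t_m\<close>; the noise after \<open>t_m\<close> is independent of the past and of the observations,
and integrating it out (\<open>markov_future\<close>) leaves a function of that state, which is almost surely
\<open>Fbar\<close> at that state. So survival and \<open>\<Phi>\<close> of the states have the same integral over every event of
the observations, hence the same conditional expectation.

The crossing law of the bridge comes from the reflection principle. It is exact for a Gaussian
walk up to the overshoot at the first hit (\<open>discrete_reflection\<close>), the drift being compensated by
an exponential weight in the end value. Along dyadic grids the overshoot tends to \<open>0\<close> by
continuity of the paths (\<open>first_dyadic_hit_tendsto\<close>), and the reflection carries over to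
the path. Comparing the normal densities at a point and at its mirror image yields the
exponential in \<open>G_k\<close>.
\<close>

section \<open>Reflection of a Gaussian walk with drift\<close>

lemma brownian_motionD:
  assumes "brownian_motion M W"
  shows "prob_space M" "0 \<le> u \<Longrightarrow> W u \<in> borel_measurable M"
    "0 \<le> u \<Longrightarrow> u < v \<Longrightarrow>
      distributed M lborel (\<lambda>\<omega>. W v \<omega> - W u \<omega>) (normal_density 0 (sqrt (v - u)))"
    "\<omega> \<in> space M \<Longrightarrow> continuous_on {0..} (\<lambda>u. W u \<omega>)"
  using assms by (auto simp: brownian_motion_def)

lemma brownian_motion_indep_increments:
  assumes "brownian_motion M W" "0 \<le> r 0" "\<And>i. i < N \<Longrightarrow> r i \<le> r (Suc i)"
  shows "prob_space.indep_vars M (\<lambda>_. borel) (\<lambda>i \<omega>. W (r (Suc i)) \<omega> - W (r i) \<omega>) {..<N}"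
  using assms unfolding brownian_motion_def by blast

text \<open>Fubini's theorem for the joint law of two independent random elements. Later uses of
independence have this shape: the first element is frozen, and the inner integral, taken over an
independent copy of the second, is transformed on its own.\<close>

lemma (in prob_space) nn_integral_indep_var:
  fixes f :: "'b \<Rightarrow> 'b \<Rightarrow> ennreal"
  assumes ind: "indep_var N1 U N2 V"
    and f: "(\<lambda>p. f (fst p) (snd p)) \<in> borel_measurable (N1 \<Otimes>\<^sub>M N2)"
  shows "(\<integral>\<^sup>+\<omega>. f (U \<omega>) (V \<omega>) \<partial>M) = (\<integral>\<^sup>+\<omega>. \<integral>\<^sup>+\<omega>'. f (U \<omega>) (V \<omega>') \<partial>M \<partial>M)"
proof -
  have [measurable]: "U \<in> measurable M N1" "V \<in> measurable M N2"
    using ind by (auto simp: indep_var_distribution_eq)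
  interpret V: prob_space "distr M N2 V" by (rule prob_space_distr) simp
  note f[measurable]
  have f1 [measurable]: "(\<lambda>v. f u v) \<in> borel_measurable N2" if "u \<in> space N1" for u
    using measurable_compose[OF measurable_Pair1'[OF that] f] by simp
  have "(\<integral>\<^sup>+\<omega>. f (U \<omega>) (V \<omega>) \<partial>M)
      = (\<integral>\<^sup>+p. f (fst p) (snd p) \<partial>distr M (N1 \<Otimes>\<^sub>M N2) (\<lambda>\<omega>. (U \<omega>, V \<omega>)))"
    by (subst nn_integral_distr) auto
  also have "\<dots> = (\<integral>\<^sup>+p. f (fst p) (snd p) \<partial>(distr M N1 U \<Otimes>\<^sub>M distr M N2 V))"
    using ind by (simp add: indep_var_distribution_eq)
  also have "\<dots> = (\<integral>\<^sup>+u. \<integral>\<^sup>+v. f u v \<partial>distr M N2 V \<partial>distr M N1 U)"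
    by (subst V.nn_integral_fst[symmetric]) auto
  also have "\<dots> = (\<integral>\<^sup>+u. \<integral>\<^sup>+\<omega>'. f u (V \<omega>') \<partial>M \<partial>distr M N1 U)"
    by (intro nn_integral_cong) (auto simp: nn_integral_distr)
  also have "\<dots> = (\<integral>\<^sup>+\<omega>. \<integral>\<^sup>+\<omega>'. f (U \<omega>) (V \<omega>') \<partial>M \<partial>M)"
  proof (rule nn_integral_distr)
    have "(\<lambda>u. \<integral>\<^sup>+v. f u v \<partial>distr M N2 V) \<in> borel_measurable N1"
      using V.borel_measurable_nn_integral_fst[of "\<lambda>p. f (fst p) (snd p)" N1] by simp
    then show "(\<lambda>u. \<integral>\<^sup>+\<omega>'. f u (V \<omega>') \<partial>M) \<in> borel_measurable (distr M N1 U)"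
      by (subst measurable_cong[of _ _ "\<lambda>u. \<integral>\<^sup>+v. f u v \<partial>distr M N2 V"]) (simp_all add: nn_integral_distr)
  qed simp
  finally show ?thesis .
qed

text \<open>The exponential weight removes the drift \<open>\<mu> * l\<close>: with \<open>p\<close> the density of \<open>B + \<mu> * l\<close>, completing
the square turns \<open>exp (- \<mu> * y) * p y\<close> into a constant times the centred normal density. This is
the Cameron--Martin formula for a single increment, and it lets the reflection argument below
treat Brownian motion with drift as if it were symmetric.\<close>

lemma normal_tilt:
  fixes B :: "'a \<Rightarrow> real" and f :: "real \<Rightarrow> ennreal"
  assumes B: "distributed M lborel B (normal_density 0 (sqrt l))" and l: "0 < l"
    and [measurable]: "f \<in> borel_measurable borel"
  shows "(\<integral>\<^sup>+\<omega>. ennreal (exp (- \<mu> * (B \<omega> + \<mu> * l))) * f (B \<omega> + \<mu> * l) \<partial>M)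
    = (\<integral>\<^sup>+y. ennreal (exp (- \<mu>\<^sup>2 * l / 2) * normal_density 0 (sqrt l) y) * f y \<partial>lborel)"
proof -
  have *: "exp (- \<mu>\<^sup>2 * l / 2) * normal_density 0 (sqrt l) (\<mu> * l + x)
      = normal_density 0 (sqrt l) x * exp (- \<mu> * (x + \<mu> * l))" for x
  proof -
    have "- \<mu>\<^sup>2 * l / 2 + - (\<mu> * l + x - 0)\<^sup>2 / (2 * (sqrt l)\<^sup>2)
        = - (x - 0)\<^sup>2 / (2 * (sqrt l)\<^sup>2) + - \<mu> * (x + \<mu> * l)"
      using l by (simp add: field_simps power2_eq_square)
    then show ?thesis
      unfolding normal_density_def by (simp add: exp_add[symmetric] mult.left_commute)
  qed
  have "(\<integral>\<^sup>+\<omega>. ennreal (exp (- \<mu> * (B \<omega> + \<mu> * l))) * f (B \<omega> + \<mu> * l) \<partial>M)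
    = (\<integral>\<^sup>+x. ennreal (normal_density 0 (sqrt l) x) *
        (ennreal (exp (- \<mu> * (x + \<mu> * l))) * f (x + \<mu> * l)) \<partial>lborel)"
    by (subst distributed_nn_integral[OF B]) auto
  also have "\<dots> = (\<integral>\<^sup>+y. ennreal (exp (- \<mu>\<^sup>2 * l / 2) * normal_density 0 (sqrt l) y) * f y \<partial>lborel)"
    by (subst nn_integral_real_affine[where c = 1 and t = "\<mu> * l" and
          f = "\<lambda>y. ennreal (exp (- \<mu>\<^sup>2 * l / 2) * normal_density 0 (sqrt l) y) * f y"])
       (auto simp only: mult_1_left *, auto simp: ennreal_mult' mult.assoc add.commute)
  finally show ?thesis .
qed

lemma normal_tilt_reflect:
  fixes B :: "'a \<Rightarrow> real" and f :: "real \<Rightarrow> ennreal"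
  assumes B: "distributed M lborel B (normal_density 0 (sqrt l))" and l: "0 < l"
    and [measurable]: "f \<in> borel_measurable borel"
  shows "(\<integral>\<^sup>+\<omega>. ennreal (exp (- \<mu> * (B \<omega> + \<mu> * l))) * f (B \<omega> + \<mu> * l) \<partial>M)
    = (\<integral>\<^sup>+\<omega>. ennreal (exp (- \<mu> * (B \<omega> + \<mu> * l))) * f (- (B \<omega> + \<mu> * l)) \<partial>M)"
proof -
  have "(\<integral>\<^sup>+y. ennreal (exp (- \<mu>\<^sup>2 * l / 2) * normal_density 0 (sqrt l) y) * f y \<partial>lborel)
    = (\<integral>\<^sup>+y. ennreal (exp (- \<mu>\<^sup>2 * l / 2) * normal_density 0 (sqrt l) y) * f (- y) \<partial>lborel)"
    by (subst nn_integral_real_affine[where c = "-1" and t = 0]) (auto simp: normal_density_def)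
  then show ?thesis
    using normal_tilt[OF B l, of f \<mu>] normal_tilt[OF B l, of "\<lambda>y. f (- y)" \<mu>] by simp
qed

text \<open>Split according to the first index \<open>i\<close> at which the walk \<open>S\<close> is at or below \<open>c\<close>. The remaining
increment \<open>S K - S i\<close> is independent of the walk up to \<open>i\<close>, and under the weight
\<open>exp (- \<mu> * S K)\<close> it may be replaced by its negative, which moves the end point \<open>S K\<close> to its mirror
image \<open>2 * S i - S K\<close>. The mirror is the value actually hit, not the level \<open>c\<close>: a walk overshoots.\<close>

lemma discrete_reflection:
  fixes f :: "real \<Rightarrow> ennreal" and r :: "nat \<Rightarrow> real" and c \<mu> :: real and K :: nat
  assumes BM: "brownian_motion M W" and r0: "0 \<le> r 0"
    and r: "strict_mono_on {..K} r"
    and f [measurable]: "f \<in> borel_measurable borel"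
  defines "S \<equiv> \<lambda>i \<omega>. W (r i) \<omega> - W (r 0) \<omega> + \<mu> * (r i - r 0)"
  shows "(\<integral>\<^sup>+\<omega>. (if \<exists>i\<le>K. S i \<omega> \<le> c then ennreal (exp (- \<mu> * S K \<omega>)) * f (S K \<omega>) else 0) \<partial>M)
    = (\<integral>\<^sup>+\<omega>. (if \<exists>i\<le>K. S i \<omega> \<le> c
         then ennreal (exp (- \<mu> * S K \<omega>)) * f (2 * S (LEAST i. S i \<omega> \<le> c) \<omega> - S K \<omega>) else 0) \<partial>M)"
proof -
  interpret prob_space M using BM by (simp add: brownian_motion_def)
  have rmono: "r i \<le> r j" if "i \<le> j" "j \<le> K" for i j
    using strict_mono_on_leD[OF r, of i j] that by auto
  have rpos: "0 \<le> r i" if "i \<le> K" for i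
    using r0 rmono[of 0 i] that by simp
  have W [measurable]: "W u \<in> borel_measurable M" if "0 \<le> u" for u
    using BM that by (simp add: brownian_motion_def)
  have SM [measurable]: "S i \<in> borel_measurable M" if "i \<le> K" for i
    unfolding S_def using rpos[OF that] rpos[of 0] by (intro measurable) auto
  define first where "first i \<omega> \<longleftrightarrow> S i \<omega> \<le> c \<and> (\<forall>j<i. c < S j \<omega>)" for i \<omega>
  have first_iff: "first i \<omega> \<longleftrightarrow> (\<exists>i. S i \<omega> \<le> c) \<and> i = (LEAST i. S i \<omega> \<le> c)" for i \<omega>
    unfolding first_def
    by (metis (mono_tags, lifting) LeastI_ex Least_equality not_le not_less_Least)
  have firstM [measurable]: "Measurable.pred M (first i)" if "i \<le> K" for i
  proof -
    have [measurable]: "S j \<in> borel_measurable M" if "j \<in> {..<i}" for j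
      using that \<open>i \<le> K\<close> by (intro SM) auto
    have "Measurable.pred M (\<lambda>\<omega>. S i \<omega> \<le> c \<and> (\<forall>j\<in>{..<i}. c < S j \<omega>))"
      using that by measurable
    then show ?thesis by (simp add: first_def[abs_def] Ball_def)
  qed
  have split: "(if \<exists>i\<le>K. S i \<omega> \<le> c then g (LEAST i. S i \<omega> \<le> c) else 0)
      = (\<Sum>i\<le>K. of_bool (first i \<omega>) * g i)" for g :: "nat \<Rightarrow> ennreal" and \<omega>
  proof (cases "\<exists>i\<le>K. S i \<omega> \<le> c")
    case True
    then have "(LEAST i. S i \<omega> \<le> c) \<le> K" by (meson Least_le order_trans)
    then have "(\<Sum>i\<le>K. of_bool (first i \<omega>) * g i)
      = (\<Sum>i\<le>K. if i = (LEAST i. S i \<omega> \<le> c) then g i else 0)"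
      using True by (intro sum.cong) (auto simp: first_iff)
    also have "\<dots> = g (LEAST i. S i \<omega> \<le> c)"
      using \<open>_ \<le> K\<close> by (subst sum.delta) auto
    finally show ?thesis using True by simp
  qed (auto simp: first_def intro!: sum.neutral[symmetric])
  have step: "(\<integral>\<^sup>+\<omega>. of_bool (first i \<omega>) * (ennreal (exp (- \<mu> * S K \<omega>)) * f (S K \<omega>)) \<partial>M)
     = (\<integral>\<^sup>+\<omega>. of_bool (first i \<omega>) * (ennreal (exp (- \<mu> * S K \<omega>)) * f (2 * S i \<omega> - S K \<omega>)) \<partial>M)"
    if i: "i \<le> K" for i
  proof (cases "i = K")
    case False
    then have iK: "i < K" using i by simp
    \<comment> \<open>A coarser grid that jumps from \<open>r i\<close> straight to \<open>r K\<close>: its last increment is the one to be reflected.\<close>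
    define r' where "r' j = (if j \<le> i then r j else r K)" for j
    define \<xi> where "\<xi> j \<omega> = W (r' (Suc j)) \<omega> - W (r' j) \<omega>" for j \<omega>
    define l where "l = r K - r i"
    have l: "0 < l" using strict_mono_onD[OF r, of i K] iK by (simp add: l_def)
    have "indep_vars (\<lambda>_. borel) \<xi> {..<Suc i}"
      unfolding \<xi>_def
    proof (rule brownian_motion_indep_increments[OF BM])
      show "0 \<le> r' 0" using r0 by (simp add: r'_def)
      show "r' j \<le> r' (Suc j)" if "j < Suc i" for j
        using that rmono iK by (auto simp: r'_def less_Suc_eq_le)
    qed
    then have ind: "indep_var (PiM {..<i} (\<lambda>_. borel)) (\<lambda>\<omega>. \<lambda>j\<in>{..<i}. \<xi> j \<omega>)
        (PiM {i} (\<lambda>_. borel)) (\<lambda>\<omega>. \<lambda>j\<in>{i}. \<xi> j \<omega>)"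
      by (rule indep_var_restrict) auto
    have distr: "distributed M lborel (\<xi> i) (normal_density 0 (sqrt l))"
      using BM rpos[OF i] strict_mono_onD[OF r, of i K] iK
      by (simp add: brownian_motion_def \<xi>_def[abs_def] r'_def l_def)
    define \<phi> where "\<phi> u j = (\<Sum>k<j. u k) + \<mu> * (r j - r 0)" for u :: "nat \<Rightarrow> real" and j
    have S\<phi>: "S j \<omega> = \<phi> (\<lambda>j\<in>{..<i}. \<xi> j \<omega>) j" if "j \<le> i" for j \<omega>
    proof -
      have "(\<Sum>k<j. (\<lambda>j\<in>{..<i}. \<xi> j \<omega>) k) = (\<Sum>k<j. W (r (Suc k)) \<omega> - W (r k) \<omega>)"
        using that by (intro sum.cong) (auto simp: \<xi>_def r'_def)
      also have "\<dots> = W (r j) \<omega> - W (r 0) \<omega>" by (rule sum_lessThan_telescope)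
      finally show ?thesis by (simp add: S_def \<phi>_def)
    qed
    define \<theta> where "\<theta> u = (of_bool (\<phi> u i \<le> c \<and> (\<forall>j\<in>{..<i}. c < \<phi> u j)) :: ennreal)" for u
    have first\<theta>: "of_bool (first i \<omega>) = \<theta> (\<lambda>j\<in>{..<i}. \<xi> j \<omega>)" for \<omega>
      unfolding first_def \<theta>_def using S\<phi> by auto
    have \<phi>M [measurable]: "(\<lambda>u. \<phi> u j) \<in> borel_measurable (PiM {..<i} (\<lambda>_. borel))" if "j \<le> i" for j
      unfolding \<phi>_def using that
      by (intro borel_measurable_add borel_measurable_const borel_measurable_sum
          measurable_component_singleton) auto
    have [measurable]: "Measurable.pred (PiM {..<i} (\<lambda>_. borel)) (\<lambda>u. \<phi> u i \<le> c \<and> (\<forall>j\<in>{..<i}. c < \<phi> u j))"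
    proof -
      have [measurable]: "(\<lambda>u. \<phi> u j) \<in> borel_measurable (PiM {..<i} (\<lambda>_. borel))" if "j \<in> {..<i}" for j
        using that by (intro \<phi>M) auto
      show ?thesis by measurable
    qed
    have [measurable]: "\<theta> \<in> borel_measurable (PiM {..<i} (\<lambda>_. borel))"
      unfolding \<theta>_def[abs_def] by measurable
    have SK: "S K \<omega> = S i \<omega> + (\<xi> i \<omega> + \<mu> * l)" for \<omega>
      by (simp add: S_def \<xi>_def r'_def l_def algebra_simps)
    have expSK: "ennreal (exp (- \<mu> * S K \<omega>))
        = ennreal (exp (- \<mu> * S i \<omega>)) * ennreal (exp (- \<mu> * (\<xi> i \<omega> + \<mu> * l)))" for \<omega>
      by (subst ennreal_mult'[symmetric]) (simp_all add: SK exp_add[symmetric] algebra_simps)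
    \<comment> \<open>The sign \<open>e\<close> selects the original (\<open>1\<close>) or the reflected (\<open>-1\<close>) increment.\<close>
    have key: "(\<integral>\<^sup>+\<omega>. of_bool (first i \<omega>) * (ennreal (exp (- \<mu> * S K \<omega>)) * f (S i \<omega> + e * (\<xi> i \<omega> + \<mu> * l))) \<partial>M)
      = (\<integral>\<^sup>+\<omega>. (\<theta> (\<lambda>j\<in>{..<i}. \<xi> j \<omega>) * ennreal (exp (- \<mu> * S i \<omega>))) *
          (\<integral>\<^sup>+\<omega>'. ennreal (exp (- \<mu> * (\<xi> i \<omega>' + \<mu> * l))) * f (S i \<omega> + e * (\<xi> i \<omega>' + \<mu> * l)) \<partial>M) \<partial>M)" for e
    proof -
      have [measurable]: "\<xi> i \<in> borel_measurable M"
        using rpos[of K] rpos[OF i] by (simp add: \<xi>_def[abs_def] r'_def)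
      have "(\<integral>\<^sup>+\<omega>. of_bool (first i \<omega>) * (ennreal (exp (- \<mu> * S K \<omega>)) * f (S i \<omega> + e * (\<xi> i \<omega> + \<mu> * l))) \<partial>M)
        = (\<integral>\<^sup>+\<omega>. (\<lambda>u v. (\<theta> u * ennreal (exp (- \<mu> * \<phi> u i))) *
            (ennreal (exp (- \<mu> * (v i + \<mu> * l))) * f (\<phi> u i + e * (v i + \<mu> * l))))
            (\<lambda>j\<in>{..<i}. \<xi> j \<omega>) (\<lambda>j\<in>{i}. \<xi> j \<omega>) \<partial>M)"
        by (simp only: expSK first\<theta> S\<phi>[OF order_refl] mult_ac
            restrict_apply insertI1 if_True)
      also have "\<dots> = (\<integral>\<^sup>+\<omega>. \<integral>\<^sup>+\<omega>'. (\<lambda>u v. (\<theta> u * ennreal (exp (- \<mu> * \<phi> u i))) *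
            (ennreal (exp (- \<mu> * (v i + \<mu> * l))) * f (\<phi> u i + e * (v i + \<mu> * l))))
            (\<lambda>j\<in>{..<i}. \<xi> j \<omega>) (\<lambda>j\<in>{i}. \<xi> j \<omega>') \<partial>M \<partial>M)"
        by (rule nn_integral_indep_var[OF ind]) measurable
      also have "\<dots> = (\<integral>\<^sup>+\<omega>. (\<theta> (\<lambda>j\<in>{..<i}. \<xi> j \<omega>) * ennreal (exp (- \<mu> * S i \<omega>))) *
          (\<integral>\<^sup>+\<omega>'. ennreal (exp (- \<mu> * (\<xi> i \<omega>' + \<mu> * l))) * f (S i \<omega> + e * (\<xi> i \<omega>' + \<mu> * l)) \<partial>M) \<partial>M)"
        by (simp add: S\<phi> nn_integral_cmult)
      finally show ?thesis .
    qed
    have "(\<integral>\<^sup>+\<omega>'. ennreal (exp (- \<mu> * (\<xi> i \<omega>' + \<mu> * l))) * f (s + 1 * (\<xi> i \<omega>' + \<mu> * l)) \<partial>M)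
        = (\<integral>\<^sup>+\<omega>'. ennreal (exp (- \<mu> * (\<xi> i \<omega>' + \<mu> * l))) * f (s + (-1) * (\<xi> i \<omega>' + \<mu> * l)) \<partial>M)" for s
      using normal_tilt_reflect[OF distr l, of "\<lambda>y. f (s + y)" \<mu>] by simp
    then have "(\<integral>\<^sup>+\<omega>. of_bool (first i \<omega>) * (ennreal (exp (- \<mu> * S K \<omega>)) * f (S i \<omega> + 1 * (\<xi> i \<omega> + \<mu> * l))) \<partial>M)
      = (\<integral>\<^sup>+\<omega>. of_bool (first i \<omega>) * (ennreal (exp (- \<mu> * S K \<omega>)) * f (S i \<omega> + (-1) * (\<xi> i \<omega> + \<mu> * l))) \<partial>M)"
      unfolding key by simp
    then show ?thesis by (simp add: SK algebra_simps)
  qed simp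
  have "(\<integral>\<^sup>+\<omega>. (if \<exists>i\<le>K. S i \<omega> \<le> c then ennreal (exp (- \<mu> * S K \<omega>)) * f (S K \<omega>) else 0) \<partial>M)
     = (\<Sum>i\<le>K. \<integral>\<^sup>+\<omega>. of_bool (first i \<omega>) * (ennreal (exp (- \<mu> * S K \<omega>)) * f (S K \<omega>)) \<partial>M)"
    unfolding split[of _ "\<lambda>_. ennreal (exp (- \<mu> * S K _)) * f (S K _)"]
    by (subst nn_integral_sum) auto
  also have "\<dots> = (\<Sum>i\<le>K. \<integral>\<^sup>+\<omega>. of_bool (first i \<omega>) * (ennreal (exp (- \<mu> * S K \<omega>)) * f (2 * S i \<omega> - S K \<omega>)) \<partial>M)"
    using step by (intro sum.cong) auto
  also have "\<dots> = (\<integral>\<^sup>+\<omega>. (if \<exists>i\<le>K. S i \<omega> \<le> c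
         then ennreal (exp (- \<mu> * S K \<omega>)) * f (2 * S (LEAST i. S i \<omega> \<le> c) \<omega> - S K \<omega>) else 0) \<partial>M)"
    unfolding split[of _ "\<lambda>i. ennreal (exp (- \<mu> * S K _)) * f (2 * S i _ - S K _)"]
    by (subst nn_integral_sum) auto
  finally show ?thesis .
qed

section \<open>Dyadic approximation of continuous paths\<close>

definition dyadic :: "real \<Rightarrow> real \<Rightarrow> nat \<Rightarrow> nat \<Rightarrow> real" where
  "dyadic p q N i = p + real i * (q - p) / 2 ^ N"

lemma dyadic_0 [simp]: "dyadic p q N 0 = p"
  and dyadic_end [simp]: "dyadic p q N (2 ^ N) = q"
  by (simp_all add: dyadic_def)

lemma dyadic_refine: "dyadic p q (N + k) (i * 2 ^ k) = dyadic p q N i"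
  by (simp add: dyadic_def power_add)

lemma dyadic_bounds:
  assumes "p \<le> q" "i \<le> 2 ^ N" shows "dyadic p q N i \<in> {p..q}"
proof -
  have "real i / 2 ^ N \<le> 1" using of_nat_mono[OF assms(2), where ?'a = real] by simp
  then have "real i / 2 ^ N * (q - p) \<le> 1 * (q - p)" using assms(1) by (intro mult_right_mono) auto
  then show ?thesis using assms(1) by (simp add: dyadic_def)
qed

lemma strict_mono_dyadic: "p < q \<Longrightarrow> strict_mono_on A (dyadic p q N)"
  by (rule strict_mono_onI) (simp add: dyadic_def divide_strict_right_mono)

lemma dyadic_step_tendsto_0: "(\<lambda>N. (q - p) / 2 ^ N :: real) \<longlonglongrightarrow> 0"
  using LIMSEQ_divide_realpow_zero[of 2 "q - p"] by simp

text \<open>Rounding \<open>u\<close> down to the grid of level \<open>N\<close> costs at most one grid step.\<close>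

lemma dyadic_dense:
  assumes pq: "p < q" and u: "u \<in> {p..q}"
  obtains i where "\<And>N. i N \<le> 2 ^ N" "(\<lambda>N. dyadic p q N (i N)) \<longlonglongrightarrow> u"
proof
  define x where "x = (u - p) / (q - p)"
  have x: "0 \<le> x" "x \<le> 1" "u = p + x * (q - p)" using pq u by (auto simp: x_def field_simps)
  define i where "i N = nat \<lfloor>x * 2 ^ N\<rfloor>" for N
  have i: "real (i N) = of_int \<lfloor>x * 2 ^ N\<rfloor>" for N using x by (simp add: i_def)
  have "\<lfloor>x * 2 ^ N\<rfloor> \<le> 2 ^ N" for N
  proof -
    have "x * 2 ^ N \<le> 2 ^ N" using x by simp
    then have "\<lfloor>x * 2 ^ N\<rfloor> \<le> \<lfloor>2 ^ N :: real\<rfloor>" by (rule floor_mono)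
    then show ?thesis by simp
  qed
  then show "i N \<le> 2 ^ N" for N by (simp add: i_def nat_le_iff)
  have "\<bar>dyadic p q N (i N) - u\<bar> \<le> (q - p) / 2 ^ N" for N
  proof -
    have "dyadic p q N (i N) - u = (real (i N) - x * 2 ^ N) * ((q - p) / 2 ^ N)"
      unfolding dyadic_def by (subst x(3)) (simp add: field_simps)
    moreover have "\<bar>real (i N) - x * 2 ^ N\<bar> \<le> 1" unfolding i by linarith
    then have "\<bar>real (i N) - x * 2 ^ N\<bar> * ((q - p) / 2 ^ N) \<le> 1 * ((q - p) / 2 ^ N)"
      using pq by (intro mult_right_mono) auto
    ultimately show ?thesis using pq by (simp add: abs_mult)
  qed
  then have "(\<lambda>N. dyadic p q N (i N) - u) \<longlonglongrightarrow> 0"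
    by (intro Lim_null_comparison[OF _ dyadic_step_tendsto_0[of q p]] always_eventually) auto
  then show "(\<lambda>N. dyadic p q N (i N)) \<longlonglongrightarrow> u" by (simp add: LIM_zero_iff)
qed

text \<open>Staying strictly above a level is an uncountable condition, and its countable version on dyadic
points would only give \<open>\<ge>\<close> in the limit. The margin \<open>inverse (Suc r)\<close>, which exists because a
continuous function attains its minimum, makes the two sides equivalent. The right-hand side is
used for measurability and for expressing survival through countably many values of the path.\<close>

lemma above_iff_dyadic:
  fixes f :: "real \<Rightarrow> real"
  assumes pq: "p < q" and f: "continuous_on {p..q} f"
  shows "(\<forall>u\<in>{p..q}. a < f u) \<longleftrightarrow>
    (\<exists>r. \<forall>N i. i \<le> 2 ^ N \<longrightarrow> a + inverse (real (Suc r)) < f (dyadic p q N i))"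
proof
  assume above: "\<forall>u\<in>{p..q}. a < f u"
  obtain u0 where u0: "u0 \<in> {p..q}" "\<And>u. u \<in> {p..q} \<Longrightarrow> f u0 \<le> f u"
    using continuous_attains_inf[of "{p..q}" f] f pq by auto
  obtain r where "inverse (real (Suc r)) < f u0 - a"
    using reals_Archimedean[of "f u0 - a"] above u0 by auto
  then have "a + inverse (real (Suc r)) < f (dyadic p q N i)" if "i \<le> 2 ^ N" for N i
    using u0(2)[OF dyadic_bounds[of p q i N]] pq that by linarith
  then show "\<exists>r. \<forall>N i. i \<le> 2 ^ N \<longrightarrow> a + inverse (real (Suc r)) < f (dyadic p q N i)"
    by blast
next
  assume "\<exists>r. \<forall>N i. i \<le> 2 ^ N \<longrightarrow> a + inverse (real (Suc r)) < f (dyadic p q N i)"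
  then obtain r where r: "\<And>N i. i \<le> 2 ^ N \<Longrightarrow> a + inverse (real (Suc r)) < f (dyadic p q N i)"
    by blast
  show "\<forall>u\<in>{p..q}. a < f u"
  proof
    fix u assume u: "u \<in> {p..q}"
    obtain i where i: "\<And>N. i N \<le> 2 ^ N" "(\<lambda>N. dyadic p q N (i N)) \<longlonglongrightarrow> u"
      using dyadic_dense[OF pq u] by blast
    have "(\<lambda>N. f (dyadic p q N (i N))) \<longlonglongrightarrow> f u"
      by (rule continuous_on_tendsto_compose[OF f i(2) u])
         (use pq dyadic_bounds[OF _ i(1)] in auto)
    then have "a + inverse (real (Suc r)) \<le> f u"
      by (rule LIMSEQ_le_const) (use r[OF i(1)] in \<open>auto intro: less_imp_le\<close>)
    then show "a < f u" by (smt (verit) inverse_positive_iff_positive of_nat_0_less_iff zero_less_Suc)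
  qed
qed

lemma dyadic_hit_mono:
  assumes "i \<le> 2 ^ N" "N \<le> N'"
  obtains i' where "i' \<le> 2 ^ N'" "dyadic p q N' i' = dyadic p q N i"
proof
  show "i * 2 ^ (N' - N) \<le> 2 ^ N'"
    using mult_right_mono[OF assms(1), of "2 ^ (N' - N)"] assms(2) by (simp flip: power_add)
  show "dyadic p q N' (i * 2 ^ (N' - N)) = dyadic p q N i"
    using dyadic_refine[of p q N "N' - N" i] assms(2) by simp
qed

text \<open>The overshoot vanishes: the value at the first grid hit is at most \<open>c\<close>, the value one grid step
earlier is above \<open>c\<close>, and by uniform continuity the two get arbitrarily close.\<close>

lemma first_dyadic_hit_tendsto:
  fixes f :: "real \<Rightarrow> real"
  assumes pq: "p < q" and f: "continuous_on {p..q} f" and fp: "c < f p"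
    and hit: "i0 \<le> 2 ^ N0" "f (dyadic p q N0 i0) \<le> c"
  shows "(\<lambda>N. f (dyadic p q N (LEAST i. f (dyadic p q N i) \<le> c))) \<longlonglongrightarrow> c"
proof (rule LIMSEQ_I)
  fix e :: real assume e: "0 < e"
  have "uniformly_continuous_on {p..q} f" using f by (intro compact_uniformly_continuous) auto
  then obtain d where d: "0 < d"
    "\<And>u v. u \<in> {p..q} \<Longrightarrow> v \<in> {p..q} \<Longrightarrow> dist v u < d \<Longrightarrow> dist (f v) (f u) < e"
    using e unfolding uniformly_continuous_on_def by metis
  obtain N1 where N1: "\<And>N. N1 \<le> N \<Longrightarrow> (q - p) / 2 ^ N < d"
    using LIMSEQ_D[OF dyadic_step_tendsto_0[of q p] d(1)] pq by auto
  show "\<exists>N1. \<forall>N\<ge>N1. norm (f (dyadic p q N (LEAST i. f (dyadic p q N i) \<le> c)) - c) < e"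
  proof (intro exI allI impI)
    fix N assume N: "max N0 N1 \<le> N"
    define i where "i = (LEAST i. f (dyadic p q N i) \<le> c)"
    obtain i' where "i' \<le> 2 ^ N" "dyadic p q N i' = dyadic p q N0 i0"
      using N by (auto intro: dyadic_hit_mono[OF hit(1), of N])
    then have i': "i' \<le> 2 ^ N" "f (dyadic p q N i') \<le> c"
      using hit(2) by simp_all
    have le: "f (dyadic p q N i) \<le> c" and ii: "i \<le> i'"
      unfolding i_def
      using LeastI[of "\<lambda>i. f (dyadic p q N i) \<le> c", OF i'(2)]
        Least_le[of "\<lambda>i. f (dyadic p q N i) \<le> c", OF i'(2)] by simp_all
    have "i \<noteq> 0" using le fp by (intro notI) simp
    then obtain j where j: "i = Suc j" by (cases i) auto
    have gt: "c < f (dyadic p q N j)"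
      using not_less_Least[of j "\<lambda>i. f (dyadic p q N i) \<le> c"] j by (simp add: i_def)
    have "dyadic p q N i - dyadic p q N j = (q - p) / 2 ^ N"
      by (simp add: dyadic_def j field_simps)
    then have "dist (dyadic p q N i) (dyadic p q N j) < d"
      using N1[of N] N pq by (simp add: dist_real_def)
    then have "dist (f (dyadic p q N i)) (f (dyadic p q N j)) < e"
      using pq ii i'(1) j by (intro d(2) dyadic_bounds) auto
    then show "norm (f (dyadic p q N (LEAST i. f (dyadic p q N i) \<le> c)) - c) < e"
      using le gt unfolding i_def[symmetric] by (simp add: dist_real_def)
  qed
qed

section \<open>Crossing law of Brownian motion with drift\<close>

definition drifted :: "(real \<Rightarrow> 'a \<Rightarrow> real) \<Rightarrow> real \<Rightarrow> real \<Rightarrow> real \<Rightarrow> 'a \<Rightarrow> real" where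
  "drifted W \<mu> p u \<omega> = W u \<omega> - W p \<omega> + \<mu> * (u - p)"

lemma drifted_measurable:
  assumes "brownian_motion M W" "0 \<le> p" "0 \<le> u"
  shows "drifted W \<mu> p u \<in> borel_measurable M"
  using brownian_motionD(2)[OF assms(1)] assms(2,3) by (simp add: drifted_def[abs_def])

lemma continuous_on_drifted:
  assumes "brownian_motion M W" "0 \<le> p" "\<omega> \<in> space M"
  shows "continuous_on {p..q} (\<lambda>u. drifted W \<mu> p u \<omega>)"
  unfolding drifted_def using assms(2)
  by (intro continuous_intros continuous_on_subset[OF brownian_motionD(4)[OF assms(1,3)]]) auto

lemma drifted_tilt:
  assumes BM: "brownian_motion M W" and pq: "0 \<le> p" "p < q"
    and f [measurable]: "(f :: real \<Rightarrow> ennreal) \<in> borel_measurable borel"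
  shows "(\<integral>\<^sup>+\<omega>. ennreal (exp (- \<mu> * drifted W \<mu> p q \<omega>)) * f (drifted W \<mu> p q \<omega>) \<partial>M)
    = (\<integral>\<^sup>+y. ennreal (exp (- \<mu>\<^sup>2 * (q - p) / 2) * normal_density 0 (sqrt (q - p)) y) * f y \<partial>lborel)"
  using normal_tilt[OF brownian_motionD(3)[OF BM pq] _ f, of \<mu>] pq by (simp add: drifted_def)

lemma drifted_tilt_finite:
  assumes BM: "brownian_motion M W" and pq: "0 \<le> p" "p < q"
  shows "(\<integral>\<^sup>+\<omega>. ennreal (exp (- \<mu> * drifted W \<mu> p q \<omega>)) \<partial>M) < \<infinity>"
proof -
  interpret prob_space M by (rule brownian_motionD(1)[OF BM])
  have "(\<integral>\<^sup>+\<omega>. ennreal (exp (- \<mu> * drifted W \<mu> p q \<omega>)) \<partial>M)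
      = (\<integral>\<^sup>+y. ennreal (exp (- \<mu>\<^sup>2 * (q - p) / 2)) * (ennreal (normal_density 0 (sqrt (q - p)) y) * 1) \<partial>lborel)"
    using drifted_tilt[OF BM pq, of "\<lambda>_. 1" \<mu>] by (simp add: ennreal_mult')
  also have "\<dots> = ennreal (exp (- \<mu>\<^sup>2 * (q - p) / 2)) * (\<integral>\<^sup>+\<omega>. 1 \<partial>M)"
    using distributed_nn_integral[OF brownian_motionD(3)[OF BM pq], of "\<lambda>_. 1"]
    by (subst nn_integral_cmult) (auto simp del: nn_integral_const)
  finally show ?thesis by (simp add: emeasure_space_1)
qed

text \<open>The limit of the discrete reflection along dyadic grids, tested on half-lines. The level \<open>z\<close> is
at least \<open>c\<close>, so a path whose mirrored end point exceeds \<open>z\<close> ends below \<open>c\<close> and has therefore hit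
\<open>c\<close>; this is why no hitting event is left on the right-hand side. Half-lines have a single
boundary point, and the end value avoids it almost surely, so the indicators converge.\<close>

lemma dyadic_reflection:
  fixes \<mu> :: real
  assumes BM: "brownian_motion M W" and pq: "0 \<le> p" "p < q" and c: "c < 0" "c \<le> z"
  defines "S \<equiv> drifted W \<mu> p"
  shows "(\<integral>\<^sup>+\<omega>. ennreal (exp (- \<mu> * S q \<omega>)) *
           of_bool (z < S q \<omega> \<and> (\<exists>N i. i \<le> 2 ^ N \<and> S (dyadic p q N i) \<omega> \<le> c)) \<partial>M)
    = (\<integral>\<^sup>+\<omega>. ennreal (exp (- \<mu> * S q \<omega>)) * of_bool (S q \<omega> < 2 * c - z) \<partial>M)"
    (is "nn_integral M ?L = nn_integral M ?R")
proof -
  interpret prob_space M by (rule brownian_motionD(1)[OF BM])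
  have dy: "p \<le> dyadic p q N i" for N i using pq by (simp add: dyadic_def)
  have dy0: "0 \<le> dyadic p q N i" for N i using dy[of N i] pq by simp
  have SM [measurable]: "S u \<in> borel_measurable M" if "0 \<le> u" for u
    unfolding S_def by (rule drifted_measurable[OF BM pq(1) that])
  have [measurable]: "S q \<in> borel_measurable M" using SM[of q] pq by simp
  have SdM [measurable]: "S (dyadic p q N i) \<in> borel_measurable M" for N i by (rule SM[OF dy0])
  have Sp: "S p \<omega> = 0" for \<omega> by (simp add: S_def drifted_def)
  define D where "D N \<omega> = S (dyadic p q N (LEAST i. S (dyadic p q N i) \<omega> \<le> c)) \<omega>" for N \<omega>
  have DM: "(\<lambda>\<omega>. D N \<omega>) \<in> borel_measurable M" for N
  proof -
    have "(\<lambda>\<omega>. S (dyadic p q N ((\<lambda>\<omega>. LEAST i. S (dyadic p q N i) \<omega> \<le> c) \<omega>)) \<omega>) \<in> borel_measurable M"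
      by (rule measurable_compose_countable) (rule SdM, measurable)
    then show ?thesis by (simp add: D_def)
  qed
  note DM [measurable]
  let ?hit = "\<lambda>N \<omega>. \<exists>i\<le>2 ^ N. S (dyadic p q N i) \<omega> \<le> c"
  let ?e = "\<lambda>\<omega>. ennreal (exp (- \<mu> * S q \<omega>))"
  let ?LN = "\<lambda>N \<omega>. ?e \<omega> * of_bool (z < S q \<omega> \<and> ?hit N \<omega>)"
  let ?RN = "\<lambda>N \<omega>. ?e \<omega> * of_bool (z < 2 * D N \<omega> - S q \<omega> \<and> ?hit N \<omega>)"
  have eq: "nn_integral M (?LN N) = nn_integral M (?RN N)" for N
  proof -
    have "nn_integral M (?LN N)
      = (\<integral>\<^sup>+\<omega>. (if ?hit N \<omega> then ?e \<omega> * of_bool (z < S q \<omega>) else 0) \<partial>M)"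
      by (intro nn_integral_cong) auto
    also have "\<dots> = (\<integral>\<^sup>+\<omega>. (if ?hit N \<omega> then ?e \<omega> * of_bool (z < 2 * D N \<omega> - S q \<omega>) else 0) \<partial>M)"
      using discrete_reflection[OF BM, of "dyadic p q N" "2 ^ N" "\<lambda>y. of_bool (z < y)" \<mu> c]
        strict_mono_dyadic[OF pq(2)] pq
      by (simp add: S_def D_def drifted_def cong: if_cong)
    also have "\<dots> = nn_integral M (?RN N)"
      by (intro nn_integral_cong) auto
    finally show ?thesis .
  qed
  have finite: "nn_integral M ?e < \<infinity>"
    unfolding S_def by (rule drifted_tilt_finite[OF BM pq])
  have hit_ev: "eventually (\<lambda>N. ?hit N \<omega> \<longleftrightarrow> (\<exists>N i. i \<le> 2 ^ N \<and> S (dyadic p q N i) \<omega> \<le> c)) sequentially" for \<omega>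
  proof (cases "\<exists>N i. i \<le> 2 ^ N \<and> S (dyadic p q N i) \<omega> \<le> c")
    case True
    then obtain N0 i0 where 0: "i0 \<le> 2 ^ N0" "S (dyadic p q N0 i0) \<omega> \<le> c" by blast
    have "?hit N \<omega>" if "N0 \<le> N" for N
      using dyadic_hit_mono[OF 0(1) that, of p q] 0(2) by metis
    then show ?thesis using True unfolding eventually_sequentially by blast
  qed (auto intro: always_eventually)
  have "(\<lambda>N. nn_integral M (?LN N)) \<longlonglongrightarrow> nn_integral M ?L"
  proof (rule nn_integral_dominated_convergence[where w = ?e])
    show "AE \<omega> in M. (\<lambda>N. ?LN N \<omega>) \<longlonglongrightarrow> ?L \<omega>"
      by (rule AE_I2, rule tendsto_eventually, use hit_ev in eventually_elim) auto
  qed (use finite in \<open>auto intro!: AE_I2\<close>)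
  moreover have "(\<lambda>N. nn_integral M (?RN N)) \<longlonglongrightarrow> nn_integral M ?R"
  proof (rule nn_integral_dominated_convergence[where w = ?e])
    have "AE y in lborel. 0 < ennreal (normal_density 0 (sqrt (q - p)) y) \<longrightarrow>
        y \<noteq> 2 * c - z - \<mu> * (q - p)"
      using AE_lborel_singleton[of "2 * c - z - \<mu> * (q - p)"] by eventually_elim auto
    then have "AE \<omega> in M. W q \<omega> - W p \<omega> \<noteq> 2 * c - z - \<mu> * (q - p)"
      by (subst distributed_AE2[OF brownian_motionD(3)[OF BM pq]]) auto
    then have "AE \<omega> in M. S q \<omega> \<noteq> 2 * c - z"
      by eventually_elim (auto simp: S_def drifted_def)
    then show "AE \<omega> in M. (\<lambda>N. ?RN N \<omega>) \<longlonglongrightarrow> ?R \<omega>"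
    proof (rule AE_mp, intro AE_I2 impI)
      fix \<omega> assume \<omega>: "\<omega> \<in> space M" and ne: "S q \<omega> \<noteq> 2 * c - z"
      show "(\<lambda>N. ?RN N \<omega>) \<longlonglongrightarrow> ?R \<omega>"
      proof (cases "\<exists>N i. i \<le> 2 ^ N \<and> S (dyadic p q N i) \<omega> \<le> c")
        case True
        then obtain N0 i0 where "i0 \<le> 2 ^ N0" "S (dyadic p q N0 i0) \<omega> \<le> c" by blast
        then have D: "(\<lambda>N. D N \<omega>) \<longlonglongrightarrow> c"
          unfolding D_def
          using first_dyadic_hit_tendsto[OF pq(2), of "\<lambda>u. S u \<omega>" c] Sp c
            continuous_on_drifted[OF BM pq(1) \<omega>] by (simp add: S_def)
        then have lim: "(\<lambda>N. 2 * D N \<omega> - S q \<omega> - z) \<longlonglongrightarrow> 2 * c - S q \<omega> - z"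
          by (intro tendsto_intros)
        have "eventually (\<lambda>N. z < 2 * D N \<omega> - S q \<omega> \<longleftrightarrow> S q \<omega> < 2 * c - z) sequentially"
        proof (cases "S q \<omega> < 2 * c - z")
          case True
          then show ?thesis using order_tendstoD(1)[OF lim, of 0] by (auto elim: eventually_mono)
        next
          case False
          then show ?thesis
            using order_tendstoD(2)[OF lim, of 0] ne by (auto elim: eventually_mono)
        qed
        then show ?thesis
          using hit_ev[of \<omega>] True by (intro tendsto_eventually) (auto elim: eventually_elim2)
      next
        case False
        \<comment> \<open>\<open>q\<close> is itself a dyadic point, so without a hit the path ends above \<open>c\<close>.\<close>
        have "c < S q \<omega>" using False by (metis dyadic_end not_le order_refl)
        then have "?R \<omega> = 0" using c by simp
        moreover have "?RN N \<omega> = 0" for N using False by auto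
        ultimately show ?thesis by (simp only: tendsto_const)
      qed
    qed
  qed (use finite in \<open>auto intro!: AE_I2\<close>)
  ultimately show ?thesis
    using eq LIMSEQ_unique by simp
qed

text \<open>The normal density at the mirror image \<open>2 * c - y\<close> is the density at \<open>y\<close> times
\<open>exp (- 2 * c * (c - y) / (q - p))\<close>. This factor is the crossing probability of the bridge.\<close>

lemma drifted_reflect_tail:
  fixes \<mu> :: real
  assumes BM: "brownian_motion M W" and pq: "0 \<le> p" "p < q"
  defines "S \<equiv> drifted W \<mu> p"
  shows "(\<integral>\<^sup>+\<omega>. ennreal (exp (- \<mu> * S q \<omega>)) * of_bool (S q \<omega> < 2 * c - z) \<partial>M)
    = (\<integral>\<^sup>+\<omega>. ennreal (exp (- \<mu> * S q \<omega>)) *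
        (of_bool (z < S q \<omega>) * ennreal (exp (- 2 * c * (c - S q \<omega>) / (q - p)))) \<partial>M)"
proof -
  define K where "K y = exp (- \<mu>\<^sup>2 * (q - p) / 2) * normal_density 0 (sqrt (q - p)) y" for y
  have [measurable]: "K \<in> borel_measurable borel" unfolding K_def[abs_def] by measurable
  have K: "K (2 * c + - 1 * y) = K y * exp (- 2 * c * (c - y) / (q - p))" for y
  proof -
    have "- (2 * c - y)\<^sup>2 / (2 * (q - p)) = - y\<^sup>2 / (2 * (q - p)) + - 2 * c * (c - y) / (q - p)"
    proof -
      define L where "L = q - p"
      have "0 < L" using pq by (simp add: L_def)
      then show ?thesis
        unfolding L_def[symmetric] by (simp add: field_simps power2_eq_square)
    qed
    then show ?thesis
      using pq by (simp add: K_def normal_density_def exp_add[symmetric])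
  qed
  have "(\<integral>\<^sup>+y. ennreal (K y) * of_bool (y < 2 * c - z) \<partial>lborel)
      = (\<integral>\<^sup>+y. ennreal (K (2 * c + - 1 * y)) * of_bool (z < y) \<partial>lborel)"
    by (subst nn_integral_real_affine[where c = "- 1" and t = "2 * c"])
       (auto intro!: nn_integral_cong)
  also have "\<dots> = (\<integral>\<^sup>+y. ennreal (K y) *
      (of_bool (z < y) * ennreal (exp (- 2 * c * (c - y) / (q - p)))) \<partial>lborel)"
    unfolding K by (intro nn_integral_cong) (simp add: ennreal_mult'' mult_ac)
  finally show ?thesis
    using drifted_tilt[OF BM pq, of "\<lambda>y. of_bool (y < 2 * c - z)" \<mu>]
      drifted_tilt[OF BM pq, of "\<lambda>y. of_bool (z < y) * ennreal (exp (- 2 * c * (c - y) / (q - p)))" \<mu>]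
    by (simp add: S_def K_def)
qed

lemma drifted_dyadic_measurable:
  assumes BM: "brownian_motion M W" and pq: "0 \<le> p" "p < q"
  shows "drifted W \<mu> p (dyadic p q N i) \<in> borel_measurable M" "drifted W \<mu> p q \<in> borel_measurable M"
  using drifted_measurable[OF BM pq(1)] pq by (simp_all add: dyadic_def)

text \<open>Equality on half-lines determines the weighted law of the end value on the hitting event; the
weight \<open>exp (- \<mu> * S q)\<close> is a function of the end value and can be divided out. The resulting
formula does not contain \<open>\<mu>\<close>: given its end point, the bridge has forgotten the drift.\<close>

lemma dyadic_hit_law:
  fixes \<mu> :: real and f :: "real \<Rightarrow> ennreal"
  assumes BM: "brownian_motion M W" and pq: "0 \<le> p" "p < q" and c: "c < 0"
    and f [measurable]: "f \<in> borel_measurable borel"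
  defines "S \<equiv> drifted W \<mu> p"
  shows "(\<integral>\<^sup>+\<omega>. of_bool (c < S q \<omega> \<and> (\<exists>N i. i \<le> 2 ^ N \<and> S (dyadic p q N i) \<omega> \<le> c)) * f (S q \<omega>) \<partial>M)
    = (\<integral>\<^sup>+\<omega>. of_bool (c < S q \<omega>) * ennreal (exp (- 2 * c * (c - S q \<omega>) / (q - p))) * f (S q \<omega>) \<partial>M)"
proof -
  note [measurable] = drifted_dyadic_measurable[OF BM pq, of \<mu>, folded S_def]
  define H where "H \<omega> \<longleftrightarrow> (\<exists>N i. i \<le> 2 ^ N \<and> S (dyadic p q N i) \<omega> \<le> c)" for \<omega>
  have [measurable]: "Measurable.pred M H" unfolding H_def[abs_def] by measurable
  let ?e = "\<lambda>\<omega>. ennreal (exp (- \<mu> * S q \<omega>))"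
  let ?A = "\<lambda>\<omega>. ?e \<omega> * of_bool (c < S q \<omega> \<and> H \<omega>)"
  let ?B = "\<lambda>\<omega>. ?e \<omega> * (of_bool (c < S q \<omega>) * ennreal (exp (- 2 * c * (c - S q \<omega>) / (q - p))))"
  have emA: "emeasure (distr (density M ?A) borel (S q)) {x<..}
    = (\<integral>\<^sup>+\<omega>. ?e \<omega> * of_bool (max x c < S q \<omega> \<and> H \<omega>) \<partial>M)" for x
    by (subst emeasure_distr) (auto simp: emeasure_density intro!: nn_integral_cong split: split_indicator)
  have emB: "emeasure (distr (density M ?B) borel (S q)) {x<..}
    = (\<integral>\<^sup>+\<omega>. ?e \<omega> * (of_bool (max x c < S q \<omega>) * ennreal (exp (- 2 * c * (c - S q \<omega>) / (q - p)))) \<partial>M)" for x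
    by (subst emeasure_distr) (auto simp: emeasure_density intro!: nn_integral_cong split: split_indicator)
  have "distr (density M ?A) borel (S q) = distr (density M ?B) borel (S q)"
  proof (rule measure_eqI_lessThan)
    fix x
    have "(\<integral>\<^sup>+\<omega>. ?e \<omega> * of_bool (max x c < S q \<omega> \<and> H \<omega>) \<partial>M) \<le> (\<integral>\<^sup>+\<omega>. ?e \<omega> \<partial>M)"
      by (intro nn_integral_mono) auto
    also have "\<dots> < \<infinity>" unfolding S_def by (rule drifted_tilt_finite[OF BM pq])
    finally show "emeasure (distr (density M ?A) borel (S q)) {x<..} < \<infinity>" unfolding emA .
    show "emeasure (distr (density M ?A) borel (S q)) {x<..} = emeasure (distr (density M ?B) borel (S q)) {x<..}"
      unfolding emA emB
      using dyadic_reflection[OF BM pq c, of "max x c" \<mu>] drifted_reflect_tail[OF BM pq, of \<mu> c "max x c"]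
      by (simp only: S_def H_def)
  qed simp_all
  then have "(\<integral>\<^sup>+y. ennreal (exp (\<mu> * y)) * f y \<partial>distr (density M ?A) borel (S q))
    = (\<integral>\<^sup>+y. ennreal (exp (\<mu> * y)) * f y \<partial>distr (density M ?B) borel (S q))" by simp
  moreover have "ennreal (exp (- \<mu> * y)) * a * (ennreal (exp (\<mu> * y)) * b) = a * b" for y a b
  proof -
    have "ennreal (exp (- \<mu> * y)) * ennreal (exp (\<mu> * y)) = 1"
      by (simp add: exp_minus flip: ennreal_mult)
    then show ?thesis by (metis (no_types, lifting) mult.assoc mult.commute mult.right_neutral)
  qed
  ultimately show ?thesis
    by (simp add: nn_integral_distr nn_integral_density H_def)
qed

text \<open>Up to time \<open>q\<close> the path reaches \<open>c\<close> exactly when it gets, at dyadic points, below every larger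
level. So the hitting event is the decreasing limit of the dyadic hitting events for the levels \<open>c + inverse (Suc r)\<close>, and the formula is continuous in the
level.\<close>

lemma hit_law:
  fixes \<mu> :: real and f :: "real \<Rightarrow> ennreal"
  assumes BM: "brownian_motion M W" and pq: "0 \<le> p" "p < q" and c: "c < 0"
    and f [measurable]: "f \<in> borel_measurable borel" and f1: "\<And>y. f y \<le> 1"
  defines "S \<equiv> drifted W \<mu> p"
  shows "(\<integral>\<^sup>+\<omega>. of_bool (c < S q \<omega> \<and> \<not> (\<forall>u\<in>{p..q}. c < S u \<omega>)) * f (S q \<omega>) \<partial>M)
    = (\<integral>\<^sup>+\<omega>. of_bool (c < S q \<omega>) * ennreal (exp (- 2 * c * (c - S q \<omega>) / (q - p))) * f (S q \<omega>) \<partial>M)"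
    (is "nn_integral M ?L = nn_integral M ?R")
proof -
  interpret prob_space M by (rule brownian_motionD(1)[OF BM])
  note [measurable] = drifted_dyadic_measurable[OF BM pq, of \<mu>, folded S_def]
  define d where "d r = c + inverse (real (Suc r))" for r
  have d: "d \<longlonglongrightarrow> c"
    unfolding d_def using tendsto_add[OF tendsto_const LIMSEQ_inverse_real_of_nat, of c] by simp
  have dc: "c < d r" for r by (simp add: d_def)
  have d_mono: "d r' \<le> d r" if "r \<le> r'" for r r'
    using that by (simp add: d_def field_simps)
  define H where "H r \<omega> \<longleftrightarrow> (\<exists>N i. i \<le> 2 ^ N \<and> S (dyadic p q N i) \<omega> \<le> d r)" for r \<omega>
  have [measurable]: "Measurable.pred M (H r)" for r unfolding H_def[abs_def] by measurable
  have above: "(\<forall>u\<in>{p..q}. c < S u \<omega>) \<longleftrightarrow> (\<exists>r. \<not> H r \<omega>)" if "\<omega> \<in> space M" for \<omega>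
  proof -
    have "\<not> H r \<omega> \<longleftrightarrow> (\<forall>N i. i \<le> 2 ^ N \<longrightarrow> c + inverse (real (Suc r)) < S (dyadic p q N i) \<omega>)" for r
      unfolding H_def d_def by (meson not_le)
    then show ?thesis
      unfolding S_def using above_iff_dyadic[OF pq(2) continuous_on_drifted[OF BM pq(1) that]]
      by (simp only:)
  qed
  have [measurable]: "Measurable.pred M (\<lambda>\<omega>. \<forall>u\<in>{p..q}. c < S u \<omega>)"
    by (subst measurable_cong[OF above]) measurable
  let ?LN = "\<lambda>r \<omega>. of_bool (d r < S q \<omega> \<and> H r \<omega>) * f (S q \<omega>)"
  let ?RN = "\<lambda>r \<omega>. of_bool (d r < S q \<omega>) * ennreal (exp (- 2 * d r * (d r - S q \<omega>) / (q - p))) * f (S q \<omega>)"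
  have d_ev: "eventually (\<lambda>r. d r < S q \<omega> \<longleftrightarrow> c < S q \<omega>) sequentially" for \<omega>
  proof (cases "c < S q \<omega>")
    case True
    then show ?thesis using order_tendstoD(2)[OF d True] by (auto elim: eventually_mono)
  next
    case False
    then show ?thesis using less_trans[OF dc] by (intro always_eventually) blast
  qed
  have H_ev: "eventually (\<lambda>r. H r \<omega> \<longleftrightarrow> \<not> (\<forall>u\<in>{p..q}. c < S u \<omega>)) sequentially"
    if "\<omega> \<in> space M" for \<omega>
  proof (cases "\<exists>r. \<not> H r \<omega>")
    case True
    then obtain r0 where r0: "\<not> H r0 \<omega>" by blast
    have "\<not> H r \<omega>" if "r0 \<le> r" for r
      using r0 d_mono[OF that] unfolding H_def by (meson order_trans)
    then show ?thesis unfolding above[OF that] eventually_sequentially using True by blast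
  next
    case False
    then show ?thesis unfolding above[OF that] by (intro always_eventually) blast
  qed
  obtain r0 where r0: "d r0 < 0"
    using order_tendstoD(2)[OF d c] unfolding eventually_sequentially by blast
  have limL: "(\<lambda>r. nn_integral M (?LN r)) \<longlonglongrightarrow> nn_integral M ?L"
  proof (rule nn_integral_dominated_convergence[where w = "\<lambda>_. 1"])
    show "AE \<omega> in M. (\<lambda>r. ?LN r \<omega>) \<longlonglongrightarrow> ?L \<omega>"
    proof (rule AE_I2, rule tendsto_eventually)
      fix \<omega> assume \<omega>: "\<omega> \<in> space M"
      show "eventually (\<lambda>r. ?LN r \<omega> = ?L \<omega>) sequentially"
        using eventually_conj[OF d_ev[of \<omega>] H_ev[OF \<omega>]] by (rule eventually_mono) simp
    qed
    show "AE \<omega> in M. ?LN r \<omega> \<le> 1" for r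
      by (rule AE_I2) (use f1 in auto)
  qed (measurable, measurable, measurable, simp add: emeasure_space_1)
  have limR: "(\<lambda>r. nn_integral M (?RN r)) \<longlonglongrightarrow> nn_integral M ?R"
  proof (rule LIMSEQ_offset[where k = r0])
    \<comment> \<open>From \<open>r0\<close> on the level is negative and the exponential factor is at most \<open>1\<close>.\<close>
    show "(\<lambda>r. nn_integral M (?RN (r + r0))) \<longlonglongrightarrow> nn_integral M ?R"
    proof (rule nn_integral_dominated_convergence[where w = "\<lambda>_. 1"])
      show "AE \<omega> in M. (\<lambda>r. ?RN (r + r0) \<omega>) \<longlonglongrightarrow> ?R \<omega>"
      proof (rule AE_I2, rule LIMSEQ_ignore_initial_segment)
        fix \<omega>
        have fS: "f (S q \<omega>) \<noteq> \<top>" using f1[of "S q \<omega>"] by (auto simp: top_unique)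
        have ob: "(\<lambda>r. of_bool (d r < S q \<omega>) :: ennreal) \<longlonglongrightarrow> of_bool (c < S q \<omega>)"
          by (rule tendsto_eventually) (use d_ev[of \<omega>] in \<open>auto elim: eventually_mono\<close>)
        have "(\<lambda>r. ennreal (exp (- 2 * d r * (d r - S q \<omega>) / (q - p))))
            \<longlonglongrightarrow> ennreal (exp (- 2 * c * (c - S q \<omega>) / (q - p)))"
          using pq by (intro tendsto_intros d) auto
        from tendsto_mult_ennreal[OF tendsto_mult_ennreal[OF ob this] tendsto_const, of "f (S q \<omega>)"]
        show "(\<lambda>r. ?RN r \<omega>) \<longlonglongrightarrow> ?R \<omega>" using fS by (simp add: ennreal_mult_eq_top_iff)
      qed
      show "AE \<omega> in M. ?RN (r + r0) \<omega> \<le> 1" for r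
      proof (rule AE_I2)
        fix \<omega>
        show "?RN (r + r0) \<omega> \<le> 1"
        proof (cases "d (r + r0) < S q \<omega>")
          case True
          have "d (r + r0) < 0" using d_mono[of r0 "r + r0"] r0 by simp
          then have "0 \<le> d (r + r0) * (d (r + r0) - S q \<omega>)"
            using True by (intro mult_nonpos_nonpos) auto
          then have "exp (- 2 * d (r + r0) * (d (r + r0) - S q \<omega>) / (q - p)) \<le> 1"
            using pq by (simp add: divide_nonpos_pos mult.assoc)
          then show ?thesis
            using True f1[of "S q \<omega>"] mult_mono[of _ "1::ennreal" "f (S q \<omega>)" 1] by simp
        qed simp
      qed
    qed (simp_all add: emeasure_space_1)
  qed
  have "eventually (\<lambda>r. nn_integral M (?LN r) = nn_integral M (?RN r)) sequentially"
    using order_tendstoD(2)[OF d c]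
  proof eventually_elim
    case (elim r)
    show ?case using dyadic_hit_law[OF BM pq elim f, of \<mu>] by (simp add: S_def H_def)
  qed
  from LIMSEQ_unique[OF Lim_transform_eventually[OF limL this] limR]
  show ?thesis .
qed

text \<open>Survival is the complement of hitting within the event that the end value is above \<open>c\<close>.\<close>

lemma no_hit_law:
  fixes \<mu> :: real and f :: "real \<Rightarrow> ennreal"
  assumes BM: "brownian_motion M W" and pq: "0 \<le> p" "p < q" and c: "c < 0"
    and f [measurable]: "f \<in> borel_measurable borel" and f1: "\<And>y. f y \<le> 1"
  defines "S \<equiv> drifted W \<mu> p"
  shows "(\<integral>\<^sup>+\<omega>. of_bool (\<forall>u\<in>{p..q}. c < S u \<omega>) * f (S q \<omega>) \<partial>M)
    = (\<integral>\<^sup>+\<omega>. of_bool (c < S q \<omega>) * ennreal (1 - exp (- 2 * c * (c - S q \<omega>) / (q - p))) * f (S q \<omega>) \<partial>M)"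
    (is "nn_integral M ?A = nn_integral M ?B")
proof -
  interpret prob_space M by (rule brownian_motionD(1)[OF BM])
  note [measurable] = drifted_dyadic_measurable[OF BM pq, of \<mu>, folded S_def]
  have above: "(\<forall>u\<in>{p..q}. c < S u \<omega>) \<longleftrightarrow>
      (\<exists>r. \<forall>N i. i \<le> 2 ^ N \<longrightarrow> c + inverse (real (Suc r)) < S (dyadic p q N i) \<omega>)"
    if "\<omega> \<in> space M" for \<omega>
    using above_iff_dyadic[OF pq(2) continuous_on_drifted[OF BM pq(1) that], of c \<mu>]
    by (simp add: S_def)
  have [measurable]: "Measurable.pred M (\<lambda>\<omega>. \<forall>u\<in>{p..q}. c < S u \<omega>)"
    by (subst measurable_cong[OF above]) measurable
  let ?A' = "\<lambda>\<omega>. of_bool (c < S q \<omega> \<and> \<not> (\<forall>u\<in>{p..q}. c < S u \<omega>)) * f (S q \<omega>)"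
  let ?B' = "\<lambda>\<omega>. of_bool (c < S q \<omega>) * ennreal (exp (- 2 * c * (c - S q \<omega>) / (q - p))) * f (S q \<omega>)"
  have "nn_integral M ?A + nn_integral M ?A' = (\<integral>\<^sup>+\<omega>. of_bool (c < S q \<omega>) * f (S q \<omega>) \<partial>M)"
    using pq by (subst nn_integral_add[symmetric], measurable) (auto intro!: nn_integral_cong)
  also have "\<dots> = nn_integral M ?B + nn_integral M ?B'"
  proof (subst nn_integral_add[symmetric], measurable, intro nn_integral_cong)
    fix \<omega>
    show "of_bool (c < S q \<omega>) * f (S q \<omega>) = ?B \<omega> + ?B' \<omega>"
    proof (cases "c < S q \<omega>")
      case True
      then have "0 \<le> c * (c - S q \<omega>)" using c by (intro mult_nonpos_nonpos) auto
      then have "exp (- 2 * c * (c - S q \<omega>) / (q - p)) \<le> 1"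
        using pq by (simp add: divide_nonpos_pos mult.assoc)
      then have "ennreal (1 - exp (- 2 * c * (c - S q \<omega>) / (q - p)))
          + ennreal (exp (- 2 * c * (c - S q \<omega>) / (q - p))) = 1"
        by (subst ennreal_plus[symmetric]) auto
      then have "f (S q \<omega>) = (ennreal (1 - exp (- 2 * c * (c - S q \<omega>) / (q - p)))
          + ennreal (exp (- 2 * c * (c - S q \<omega>) / (q - p)))) * f (S q \<omega>)" by simp
      then show ?thesis using True by (simp only: distrib_right of_bool_eq mult_1_left) 
    qed simp
  qed
  also have "nn_integral M ?B' = nn_integral M ?A'"
    using hit_law[OF BM pq c f f1, of \<mu>] by (simp add: S_def)
  finally have "nn_integral M ?A' + nn_integral M ?A = nn_integral M ?A' + nn_integral M ?B"
    by (simp add: add.commute)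
  moreover have "nn_integral M ?A' \<le> (\<integral>\<^sup>+\<omega>. 1 \<partial>M)"
    by (intro nn_integral_mono) (use f1 in auto)
  then have "nn_integral M ?A' \<noteq> \<top>"
    by (auto simp: emeasure_space_1 top_unique)
  ultimately show ?thesis by simp
qed

text \<open>The rule that turns the survival of one interval into a function of its end points. Dividing by
\<open>\<kappa>\<close> reduces \<open>x + \<beta> * (u - p) + \<kappa> * (W u - W p) > a\<close> to a unit-volatility motion with drift
\<open>\<beta> / \<kappa>\<close> above the level \<open>(a - x) / \<kappa>\<close>. Positivity of \<open>\<kappa>\<close> is asked for only from starting points
at or above \<open>a\<close>, because the volatility of the scheme may degenerate at negative states.\<close>

lemma brownian_bridge_survival:
  fixes a x \<beta> \<kappa> :: real and f :: "real \<Rightarrow> ennreal"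
  assumes BM: "brownian_motion M W" and pq: "0 \<le> p" "p < q"
    and \<kappa>: "a \<le> x \<Longrightarrow> 0 < \<kappa>"
    and f [measurable]: "f \<in> borel_measurable borel" and f1: "\<And>y. f y \<le> 1"
  defines "x' \<equiv> \<lambda>\<omega>. x + \<beta> * (q - p) + \<kappa> * (W q \<omega> - W p \<omega>)"
  shows "(\<integral>\<^sup>+\<omega>. of_bool (\<forall>u\<in>{p..q}. a < x + \<beta> * (u - p) + \<kappa> * (W u \<omega> - W p \<omega>)) * f (W q \<omega> - W p \<omega>) \<partial>M)
    = (\<integral>\<^sup>+\<omega>. ennreal (if a \<le> x \<and> a \<le> x' \<omega>
          then 1 - exp (- (2 * (x - a) * (x' \<omega> - a) / ((q - p) * \<kappa>\<^sup>2))) else 0) * f (W q \<omega> - W p \<omega>) \<partial>M)"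
proof (cases "x \<le> a")
  case True
  \<comment> \<open>At \<open>u = p\<close> the path is not above \<open>a\<close>, and the factor vanishes even for \<open>x = a\<close>.\<close>
  have "(\<forall>u\<in>{p..q}. a < x + \<beta> * (u - p) + \<kappa> * (W u \<omega> - W p \<omega>)) = False" for \<omega>
    using True pq by (auto intro!: bexI[of _ p])
  then show ?thesis using True by (simp only:) (simp cong: if_cong)
next
  case False
  then have \<kappa>: "0 < \<kappa>" using \<kappa> by simp
  define c \<mu> where "c = (a - x) / \<kappa>" and "\<mu> = \<beta> / \<kappa>"
  have c: "c < 0" using False \<kappa> by (simp add: c_def divide_neg_pos)
  have S: "x + \<beta> * (u - p) + \<kappa> * (W u \<omega> - W p \<omega>) = a + \<kappa> * (drifted W \<mu> p u \<omega> - c)" for u \<omega>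
    using \<kappa> by (simp add: drifted_def c_def \<mu>_def field_simps)
  have iff: "a < x + \<beta> * (u - p) + \<kappa> * (W u \<omega> - W p \<omega>) \<longleftrightarrow> c < drifted W \<mu> p u \<omega>" for u \<omega>
    unfolding S using \<kappa> by (simp add: zero_less_mult_iff)
  have x': "x' \<omega> = a + \<kappa> * (drifted W \<mu> p q \<omega> - c)" for \<omega> unfolding x'_def S ..
  have factor: "(if a \<le> x \<and> a \<le> x' \<omega>
          then 1 - exp (- (2 * (x - a) * (x' \<omega> - a) / ((q - p) * \<kappa>\<^sup>2))) else 0)
    = of_bool (c < drifted W \<mu> p q \<omega>) * (1 - exp (- 2 * c * (c - drifted W \<mu> p q \<omega>) / (q - p)))" for \<omega>
  proof -
    have xa: "x - a = - (\<kappa> * c)" using \<kappa> by (simp add: c_def)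
    have "2 * (x - a) * (x' \<omega> - a) = (2 * c * (c - drifted W \<mu> p q \<omega>)) * \<kappa>\<^sup>2"
      unfolding xa x' by (simp add: algebra_simps power2_eq_square)
    then have "2 * (x - a) * (x' \<omega> - a) / ((q - p) * \<kappa>\<^sup>2) = 2 * c * (c - drifted W \<mu> p q \<omega>) / (q - p)"
      using \<kappa> by simp
    moreover have "a \<le> x' \<omega> \<longleftrightarrow> c \<le> drifted W \<mu> p q \<omega>"
      using \<kappa> by (simp add: x' zero_le_mult_iff)
    ultimately show ?thesis using False by (auto simp: order_less_le)
  qed
  have W: "W q \<omega> - W p \<omega> = drifted W \<mu> p q \<omega> - \<mu> * (q - p)" for \<omega>
    by (simp add: drifted_def)
  have "ennreal (of_bool P) = of_bool P" for P by (cases P) auto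
  then show ?thesis
    unfolding iff factor W
    using no_hit_law[OF BM pq c, of "\<lambda>y. f (y - \<mu> * (q - p))" \<mu>] f1
    by (simp add: ennreal_mult')
qed

section \<open>Independence of the pieces of a Brownian path\<close>

text \<open>Finite-dimensional independence determines independence of whole processes. The events that
depend on the coordinates in some \<open>C N\<close> form a system closed under intersection, because the
\<open>C N\<close> increase; finitely many of them live on a common \<open>C N\<close>, where the hypothesis applies; and
they generate the \<open>\<sigma>\<close>-algebra of the full product.\<close>

lemma (in prob_space) indep_vars_increasing_restrict:
  fixes X :: "'i \<Rightarrow> 'a \<Rightarrow> 'j \<Rightarrow> 'b" and C :: "nat \<Rightarrow> 'j set"
  assumes ind: "\<And>N. indep_vars (\<lambda>_. PiM (C N) L) (\<lambda>k \<omega>. restrict (X k \<omega>) (C N)) I"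
    and mono: "incseq C" and un: "(\<Union>N. C N) = UNIV"
  shows "indep_vars (\<lambda>_. PiM UNIV L) X I"
proof -
  have rv: "(\<lambda>\<omega>. restrict (X k \<omega>) (C N)) \<in> measurable M (PiM (C N) L)" if "k \<in> I" for k N
    using ind[of N] that by (auto simp: indep_vars_def)
  define G where "G k N = {(\<lambda>\<omega>. restrict (X k \<omega>) (C N)) -` A \<inter> space M | A. A \<in> sets (PiM (C N) L)}" for k N
  define F where "F k = (\<Union>N. G k N)" for k
  have G_mono: "G k N \<subseteq> G k N'" if k: "k \<in> I" and "N \<le> N'" for k N N'
  proof
    fix a assume "a \<in> G k N"
    then obtain A where A: "A \<in> sets (PiM (C N) L)" "a = (\<lambda>\<omega>. restrict (X k \<omega>) (C N)) -` A \<inter> space M"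
      unfolding G_def by blast
    have sub: "C N \<subseteq> C N'" using mono that(2) by (rule incseqD)
    let ?B = "(\<lambda>f. restrict f (C N)) -` A \<inter> space (PiM (C N') L)"
    have "?B \<in> sets (PiM (C N') L)"
      by (rule measurable_sets[OF measurable_restrict_subset[OF sub] A(1)])
    moreover have "a = (\<lambda>\<omega>. restrict (X k \<omega>) (C N')) -` ?B \<inter> space M"
      using measurable_space[OF rv[OF k, of N']] sub by (auto simp: A(2) Int_absorb1)
    ultimately show "a \<in> G k N'" unfolding G_def by blast
  qed
  have G_ind: "indep_sets (\<lambda>k. G k N) I" for N
    using ind[of N] by (simp add: indep_vars_def2 G_def)
  have F_ind: "indep_sets F I"
  proof (rule indep_setsI)
    show "F k \<subseteq> events" if "k \<in> I" for k
      using measurable_sets[OF rv[OF that]] by (auto simp: F_def G_def)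
    fix A J assume J: "J \<noteq> {}" "J \<subseteq> I" "finite J" and A: "\<forall>j\<in>J. A j \<in> F j"
    have "\<forall>j\<in>J. \<exists>N. A j \<in> G j N" using A by (auto simp: F_def)
    then obtain N where N: "\<And>j. j \<in> J \<Longrightarrow> A j \<in> G j (N j)" by metis
    have "A j \<in> G j (Max (N ` J))" if "j \<in> J" for j
      using N[OF that] G_mono[of j "N j" "Max (N ` J)"] that J by auto
    then show "prob (\<Inter>j\<in>J. A j) = (\<Prod>j\<in>J. prob (A j))"
      using indep_setsD[OF G_ind, of J] J by blast
  qed
  have F_stable: "Int_stable (F k)" if k: "k \<in> I" for k
  proof (rule Int_stableI)
    fix a b assume "a \<in> F k" "b \<in> F k"
    then obtain N N' where "a \<in> G k N" "b \<in> G k N'" by (auto simp: F_def)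
    then have "a \<in> G k (max N N')" "b \<in> G k (max N N')"
      using G_mono[OF k, of N "max N N'"] G_mono[OF k, of N' "max N N'"] by auto
    then obtain A B where "A \<in> sets (PiM (C (max N N')) L)" "B \<in> sets (PiM (C (max N N')) L)"
        "a = (\<lambda>\<omega>. restrict (X k \<omega>) (C (max N N'))) -` A \<inter> space M"
        "b = (\<lambda>\<omega>. restrict (X k \<omega>) (C (max N N'))) -` B \<inter> space M"
      unfolding G_def by blast
    then have "a \<inter> b \<in> G k (max N N')"
      unfolding G_def by (intro CollectI exI[of _ "A \<inter> B"]) auto
    then show "a \<inter> b \<in> F k" by (auto simp: F_def)
  qed
  have F_sub: "F k \<subseteq> Pow (space M)" for k by (auto simp: F_def G_def)
  have X_F: "X k \<in> measurable (sigma (space M) (F k)) (PiM UNIV L)" if k: "k \<in> I" for k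
  proof -
    have coord: "(\<lambda>\<omega>. X k \<omega> c) \<in> measurable (sigma (space M) (F k)) (L c)" for c
    proof -
      obtain N where N: "c \<in> C N" using un by blast
      have Xc: "(\<lambda>\<omega>. X k \<omega> c) -` B \<inter> space M = (\<lambda>\<omega>. restrict (X k \<omega>) (C N)) -`
          ((\<lambda>f. f c) -` B \<inter> space (PiM (C N) L)) \<inter> space M" for B
        using measurable_space[OF rv[OF k, of N]] N by auto
      show ?thesis
      proof (rule measurableI)
        fix B assume "B \<in> sets (L c)"
        then have "(\<lambda>f. f c) -` B \<inter> space (PiM (C N) L) \<in> sets (PiM (C N) L)"
          by (rule measurable_sets[OF measurable_component_singleton[OF N]])
        then have "(\<lambda>\<omega>. X k \<omega> c) -` B \<inter> space M \<in> F k"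
          unfolding F_def G_def Xc by blast
        then show "(\<lambda>\<omega>. X k \<omega> c) -` B \<inter> space (sigma (space M) (F k)) \<in> sets (sigma (space M) (F k))"
          using F_sub by (auto simp: sets_measure_of space_measure_of intro: sigma_sets.Basic)
      next
        fix \<omega> assume "\<omega> \<in> space (sigma (space M) (F k))"
        then have "\<omega> \<in> space M" using F_sub by (simp add: space_measure_of)
        then show "X k \<omega> c \<in> space (L c)"
          using measurable_space[OF rv[OF k, of N]] N by (fastforce simp: space_PiM PiE_iff)
      qed
    qed
    then show ?thesis
      using measurable_space[OF coord]
      by (intro measurable_PiM_single'[of UNIV "\<lambda>c \<omega>. X k \<omega> c"]) auto
  qed
  have sub: "sigma_sets (space M) {X k -` A \<inter> space M | A. A \<in> sets (PiM UNIV L)} \<subseteq> sigma_sets (space M) (F k)"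
    if "k \<in> I" for k
  proof (rule sigma_sets_mono, safe)
    fix A assume "A \<in> sets (PiM UNIV L)"
    from measurable_sets[OF X_F[OF that] this]
    show "X k -` A \<inter> space M \<in> sigma_sets (space M) (F k)"
      using F_sub by (simp add: sets_measure_of space_measure_of)
  qed
  have F_events: "sigma_sets (space M) (F k) \<subseteq> events" if "k \<in> I" for k
    using indep_sets_sigma[OF F_ind F_stable] that by (simp add: indep_sets_def)
  have "X k \<in> measurable M (PiM UNIV L)" if "k \<in> I" for k
  proof (rule measurableI)
    show "X k \<omega> \<in> space (PiM UNIV L)" if "\<omega> \<in> space M" for \<omega>
      using measurable_space[OF X_F[OF \<open>k \<in> I\<close>], of \<omega>] F_sub that by (simp add: space_measure_of)
    show "X k -` A \<inter> space M \<in> events" if "A \<in> sets (PiM UNIV L)" for A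
      using sub[OF \<open>k \<in> I\<close>] F_events[OF \<open>k \<in> I\<close>] that by (blast intro: sigma_sets.Basic)
  qed
  then show ?thesis
    unfolding indep_vars_def
    using indep_sets_mono_sets[OF indep_sets_sigma[OF F_ind F_stable] sub] by blast
qed

text \<open>Used to add the observation noise to the pieces of \<open>W\<close>: the old variables are all functions of
\<open>A\<close>, the new one is a function of \<open>B\<close>, and \<open>A\<close> is independent of \<open>B\<close>.\<close>

lemma (in prob_space) indep_vars_adjoin:
  assumes X: "indep_vars M' X I" and i: "i \<notin> I"
    and AB: "indep_var N1 A N2 B"
    and f: "\<And>k. k \<in> I \<Longrightarrow> f k \<in> measurable N1 (M' k)" "\<And>k \<omega>. k \<in> I \<Longrightarrow> X k \<omega> = f k (A \<omega>)"
    and g: "g \<in> measurable N2 (M' i)" "\<And>\<omega>. X i \<omega> = g (B \<omega>)"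
  shows "indep_vars M' X (insert i I)"
  unfolding indep_vars_def2
proof (intro conjI ballI)
  have [measurable]: "A \<in> measurable M N1" "B \<in> measurable M N2"
    using AB by (auto simp: indep_var_distribution_eq)
  have rvi: "X i \<in> measurable M (M' i)"
    using g by (simp add: measurable_compose[of B] cong: measurable_cong)
  show rv: "X k \<in> measurable M (M' k)" if "k \<in> insert i I" for k
    using that X rvi by (auto simp: indep_vars_def)
  let ?F = "\<lambda>k. {X k -` A \<inter> space M | A. A \<in> sets (M' k)}"
  have ind: "indep_sets ?F I" using X by (simp add: indep_vars_def2)
  show "indep_sets ?F (insert i I)"
  proof (rule indep_setsI)
    show "?F k \<subseteq> events" if "k \<in> insert i I" for k
      using measurable_sets[OF rv[OF that]] by auto
    fix a J assume J: "J \<noteq> {}" "J \<subseteq> insert i I" "finite J" and a: "\<forall>j\<in>J. a j \<in> ?F j"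
    show "prob (\<Inter>j\<in>J. a j) = (\<Prod>j\<in>J. prob (a j))"
    proof (cases "i \<in> J \<and> J \<noteq> {i}")
      case False
      then consider "J \<subseteq> I" | "J = {i}" using J(2) by blast
      then show ?thesis
      proof cases
        case 1
        then show ?thesis using a by (intro indep_setsD[OF ind 1 J(1,3)])
      qed simp
    next
      case True
      define K where "K = J - {i}"
      have K: "K \<subseteq> I" "K \<noteq> {}" "finite K" "J = insert i K" "i \<notin> K" using True J by (auto simp: K_def)
      obtain s where s: "\<And>j. j \<in> J \<Longrightarrow> s j \<in> sets (M' j)" "\<And>j. j \<in> J \<Longrightarrow> a j = X j -` s j \<inter> space M"
      proof -
        have "\<forall>j\<in>J. \<exists>s. s \<in> sets (M' j) \<and> a j = X j -` s \<inter> space M" using a by blast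
        then show ?thesis using that by metis
      qed
      let ?S = "\<Inter>j\<in>K. f j -` s j \<inter> space N1" and ?R = "g -` s i \<inter> space N2"
      have S: "?S \<in> sets N1"
        using K f(1) s(1) by (intro sets.finite_INT) (auto intro!: measurable_sets)
      have R: "?R \<in> sets N2" using g(1) s(1) K by (auto intro!: measurable_sets)
      have AS: "A -` ?S \<inter> space M = (\<Inter>j\<in>K. a j)"
      proof -
        have "a j = A -` (f j -` s j \<inter> space N1) \<inter> space M" if "j \<in> K" for j
          using that K(1,4) s(2)[of j] f(2)[of j] measurable_space[of A M N1] by auto
        then show ?thesis using K(2) by auto
      qed
      have BR: "B -` ?R \<inter> space M = a i"
        using K s(2) g(2) measurable_space[of B M N2] by auto
      have "(\<Inter>j\<in>J. a j) = (\<lambda>x. (A x, B x)) -` (?S \<times> ?R) \<inter> space M"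
      proof -
        have "(\<lambda>x. (A x, B x)) -` (?S \<times> ?R) \<inter> space M
            = (A -` ?S \<inter> space M) \<inter> (B -` ?R \<inter> space M)" by blast
        then show ?thesis unfolding AS BR K(4) by auto
      qed
      then have "prob (\<Inter>j\<in>J. a j) = prob (\<Inter>j\<in>K. a j) * prob (a i)"
        using indep_varD[OF AB S R] AS BR by simp
      also have "prob (\<Inter>j\<in>K. a j) = (\<Prod>j\<in>K. prob (a j))"
        using a K(4) by (intro indep_setsD[OF ind K(1,2,3)]) blast
      finally show ?thesis using K by (simp add: mult.commute)
    qed
  qed
qed

text \<open>The increments of \<open>W\<close> from \<open>p\<close> to the dyadic points of \<open>{p..q}\<close>, one family for every level
\<open>N\<close>. Indices beyond \<open>2 ^ N\<close> are truncated so that no time after \<open>q\<close> enters; a total function on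
\<open>nat \<times> nat\<close> keeps all pieces in one countable product space.\<close>

definition path_samples :: "(real \<Rightarrow> 'a \<Rightarrow> real) \<Rightarrow> real \<Rightarrow> real \<Rightarrow> 'a \<Rightarrow> nat \<times> nat \<Rightarrow> real" where
  "path_samples W p q \<omega> = (\<lambda>(N, i). W (dyadic p q N (min i (2 ^ N))) \<omega> - W p \<omega>)"

text \<open>Up to level \<open>N\<close> every sample is a sum of increments over the level-\<open>N\<close> grid of its own interval.
These grids, put end to end, form one grid of \<open>n * 2 ^ N\<close> steps, whose increments are independent.\<close>

lemma indep_path_samples_level:
  assumes BM: "brownian_motion M W" and T: "strict_mono_on {..n} T" and T0: "0 \<le> T 0"
  shows "prob_space.indep_vars M (\<lambda>_. PiM ({..N} \<times> UNIV) (\<lambda>_. borel))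
    (\<lambda>k \<omega>. restrict (path_samples W (T k) (T (Suc k)) \<omega>) ({..N} \<times> UNIV)) {..<n}"
proof -
  interpret prob_space M by (rule brownian_motionD(1)[OF BM])
  define r where "r j = dyadic (T (j div 2 ^ N)) (T (Suc (j div 2 ^ N))) N (j mod 2 ^ N)" for j
  have r: "r (k * 2 ^ N + i) = dyadic (T k) (T (Suc k)) N i" if "i \<le> 2 ^ N" for k i
  proof (cases "i = 2 ^ N")
    case True
    then have "k * 2 ^ N + i = Suc k * 2 ^ N" by simp
    then show ?thesis by (simp add: r_def True del: mult_Suc)
  qed (use that in \<open>simp add: r_def\<close>)
  have r_mono: "r j \<le> r (Suc j)" if j: "j < n * 2 ^ N" for j
  proof -
    define k i where "k = j div 2 ^ N" and "i = j mod 2 ^ N"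
    have "j = k * 2 ^ N + i" unfolding k_def i_def by (rule div_mult_mod_eq[symmetric])
    moreover have i: "i < 2 ^ N" by (simp add: i_def)
    moreover have "k < n" using j by (simp add: k_def less_mult_imp_div_less)
    then have "T k < T (Suc k)" using strict_mono_onD[OF T, of k "Suc k"] by simp
    then have "dyadic (T k) (T (Suc k)) N i < dyadic (T k) (T (Suc k)) N (Suc i)"
      using strict_mono_onD[OF strict_mono_dyadic] by blast
    ultimately show ?thesis using r[of i k] r[of "Suc i" k] by simp
  qed
  define \<xi> where "\<xi> j \<omega> = W (r (Suc j)) \<omega> - W (r j) \<omega>" for j \<omega>
  have "indep_vars (\<lambda>_. borel) \<xi> {..<n * 2 ^ N}"
    unfolding \<xi>_def
  proof (rule brownian_motion_indep_increments[OF BM])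
    show "0 \<le> r 0" using T0 r[of 0 0] by simp
  qed (rule r_mono)
  then have "indep_vars (\<lambda>k. PiM {k * 2 ^ N..<Suc k * 2 ^ N} (\<lambda>_. borel))
      (\<lambda>k \<omega>. restrict (\<lambda>j. \<xi> j \<omega>) {k * 2 ^ N..<Suc k * 2 ^ N}) {..<n}"
  proof (rule indep_vars_restrict)
    show "{k * 2 ^ N..<Suc k * 2 ^ N} \<subseteq> {..<n * 2 ^ N}" if "k \<in> {..<n}" for k
    proof -
      have "Suc k * 2 ^ N \<le> n * 2 ^ N" using that by (intro mult_right_mono) auto
      then show ?thesis by auto
    qed
    have "k = j div 2 ^ N" if "j \<in> {k * 2 ^ N..<Suc k * 2 ^ N}" for j k
      using that by (auto intro!: div_nat_eqI[symmetric] simp: mult.commute)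
    then show "disjoint_family_on (\<lambda>k. {k * 2 ^ N..<Suc k * 2 ^ N}) {..<n}"
      unfolding disjoint_family_on_def by blast
  qed
  note indep_blocks = this
  have eq: "(\<Sum>l<min i (2 ^ N') * 2 ^ (N - N'). restrict (\<lambda>j. \<xi> j \<omega>) {k * 2 ^ N..<Suc k * 2 ^ N} (k * 2 ^ N + l))
      = path_samples W (T k) (T (Suc k)) \<omega> (N', i)" if N': "N' \<le> N" for k \<omega> N' i
  proof -
    define j where "j = min i (2 ^ N') * 2 ^ (N - N')"
    have j: "j \<le> (2::nat) ^ N"
      using mult_right_mono[of "min i (2 ^ N')" "2 ^ N'" "2 ^ (N - N')"] N' by (simp add: j_def flip: power_add)
    have "(\<Sum>l<j. restrict (\<lambda>j. \<xi> j \<omega>) {k * 2 ^ N..<Suc k * 2 ^ N} (k * 2 ^ N + l))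
        = (\<Sum>l<j. W (r (k * 2 ^ N + Suc l)) \<omega> - W (r (k * 2 ^ N + l)) \<omega>)"
      using j by (intro sum.cong) (auto simp: \<xi>_def)
    also have "\<dots> = W (r (k * 2 ^ N + j)) \<omega> - W (r (k * 2 ^ N + 0)) \<omega>"
      by (rule sum_lessThan_telescope)
    also have "\<dots> = W (dyadic (T k) (T (Suc k)) N j) \<omega> - W (T k) \<omega>"
      using r[OF j, of k] r[of 0 k] by simp
    also have "dyadic (T k) (T (Suc k)) N j = dyadic (T k) (T (Suc k)) N' (min i (2 ^ N'))"
      using dyadic_refine[of _ _ N' "N - N'" "min i (2 ^ N')"] N' by (simp add: j_def)
    finally show ?thesis
      by (simp add: path_samples_def j_def)
  qed
  from indep_blocks have "indep_vars (\<lambda>_. PiM ({..N} \<times> UNIV) (\<lambda>_. borel))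
      (\<lambda>k \<omega>. (\<lambda>u. \<lambda>(N', i)\<in>{..N} \<times> UNIV. \<Sum>l<min i (2 ^ N') * 2 ^ (N - N'). u (k * 2 ^ N + l))
        (restrict (\<lambda>j. \<xi> j \<omega>) {k * 2 ^ N..<Suc k * 2 ^ N})) {..<n}"
  proof (rule indep_vars_compose2)
    fix k
    show "(\<lambda>u. \<lambda>(N', i)\<in>{..N} \<times> UNIV. \<Sum>l<min i (2 ^ N') * 2 ^ (N - N'). u (k * 2 ^ N + l))
      \<in> measurable (PiM {k * 2 ^ N..<Suc k * 2 ^ N} (\<lambda>_. borel)) (PiM ({..N} \<times> UNIV) (\<lambda>_. borel :: real measure))"
    proof (rule measurable_restrict, clarify)
      fix N' i assume "N' \<le> N"
      then have L: "min i (2 ^ N') * 2 ^ (N - N') \<le> (2::nat) ^ N"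
        using mult_right_mono[of "min i (2 ^ N')" "2 ^ N'" "2 ^ (N - N')"] by (simp flip: power_add)
      show "(\<lambda>u. \<Sum>l<min i (2 ^ N') * 2 ^ (N - N'). u (k * 2 ^ N + l))
          \<in> borel_measurable (PiM {k * 2 ^ N..<Suc k * 2 ^ N} (\<lambda>_. borel :: real measure))"
        by (intro borel_measurable_sum measurable_component_singleton) (use L in auto)
    qed
  qed
  also have "(\<lambda>k \<omega>. (\<lambda>u. \<lambda>(N', i)\<in>{..N} \<times> UNIV. \<Sum>l<min i (2 ^ N') * 2 ^ (N - N'). u (k * 2 ^ N + l))
        (restrict (\<lambda>j. \<xi> j \<omega>) {k * 2 ^ N..<Suc k * 2 ^ N}))
    = (\<lambda>k \<omega>. restrict (path_samples W (T k) (T (Suc k)) \<omega>) ({..N} \<times> UNIV))"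
    by (rule ext, rule ext, rule restrict_ext, clarify, rule eq) simp
  finally show ?thesis .
qed

lemma indep_path_samples:
  assumes BM: "brownian_motion M W" and WW': "indep_processes M W W'"
    and T: "strict_mono_on {..n} T" and T0: "0 \<le> T 0"
  defines "V \<equiv> \<lambda>k. if k < n then path_samples W (T k) (T (Suc k)) else (\<lambda>\<omega> (N, i). W' (T (min i n)) \<omega>)"
  shows "prob_space.indep_vars M (\<lambda>_. PiM UNIV (\<lambda>_. borel)) V {..n}"
proof -
  interpret prob_space M by (rule brownian_motionD(1)[OF BM])
  have Tn: "0 \<le> T k" if "k \<le> n" for k
    using T0 strict_mono_on_leD[OF T, of 0 k] that by auto
  have "indep_vars (\<lambda>_. PiM UNIV (\<lambda>_. borel)) (\<lambda>k. path_samples W (T k) (T (Suc k))) {..<n}"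
  proof (rule indep_vars_increasing_restrict[OF indep_path_samples_level[OF BM T T0]])
    show "(\<Union>N. {..N} \<times> UNIV) = (UNIV :: (nat \<times> nat) set)"
    proof (rule UNIV_eq_I[symmetric])
      show "x \<in> (\<Union>N. {..N} \<times> UNIV)" for x :: "nat \<times> nat"
        by (rule UN_I[of "fst x"]) (auto simp: mem_Times_iff)
    qed
  qed (auto simp: incseq_def)
  then have V: "indep_vars (\<lambda>_. PiM UNIV (\<lambda>_. borel)) V {..<n}"
    by (subst indep_vars_cong) (auto simp: V_def)
  have ind: "indep_var (PiM {0..} (\<lambda>_. borel)) (\<lambda>\<omega>. \<lambda>u\<in>{0..}. W u \<omega>)
       (PiM {0..} (\<lambda>_. borel)) (\<lambda>\<omega>. \<lambda>u\<in>{0..}. W' u \<omega>)"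
    using WW' by (simp add: indep_processes_def)
  have "indep_vars (\<lambda>_. PiM UNIV (\<lambda>_. borel)) V (insert n {..<n})"
  proof (rule indep_vars_adjoin[OF V _ ind])
    fix k assume k: "k \<in> {..<n}"
    have dy: "0 \<le> dyadic (T k) (T (Suc k)) N (min i (2 ^ N))" for N i
      using dyadic_bounds[of "T k" "T (Suc k)" "min i (2 ^ N)" N] Tn[of k] Tn[of "Suc k"]
        strict_mono_onD[OF T, of k "Suc k"] k by auto
    show "(\<lambda>w (N, i). w (dyadic (T k) (T (Suc k)) N (min i (2 ^ N))) - w (T k))
      \<in> measurable (PiM {0..} (\<lambda>_. borel)) (PiM UNIV (\<lambda>_. borel :: real measure))"
      using dy Tn[of k] k
      by (intro measurable_PiM_single') (auto split: prod.split intro!: borel_measurable_diff measurable_component_singleton)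
    show "V k \<omega> = (\<lambda>w (N, i). w (dyadic (T k) (T (Suc k)) N (min i (2 ^ N))) - w (T k)) (\<lambda>u\<in>{0..}. W u \<omega>)" for \<omega>
      using dy Tn[of k] k by (auto simp: V_def path_samples_def)
  next
    show "(\<lambda>w (N :: nat, i). w (T (min i n)))
      \<in> measurable (PiM {0..} (\<lambda>_. borel)) (PiM UNIV (\<lambda>_. borel :: real measure))"
      using Tn
      by (intro measurable_PiM_single') (auto split: prod.split intro!: measurable_component_singleton)
    show "V n \<omega> = (\<lambda>w (N, i). w (T (min i n))) (\<lambda>u\<in>{0..}. W' u \<omega>)" for \<omega>
      using Tn by (auto simp: V_def)
  qed simp
  then show ?thesis by (simp add: lessThan_Suc_atMost[symmetric] lessThan_Suc)
qed

section \<open>The scheme as a function of independent noise\<close>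

text \<open>The scheme as a deterministic recursion from state \<open>x\<close> at index \<open>k\<close>, driven by given
increments \<open>e\<close>. Starting at an arbitrary index is what makes the Markov property expressible.\<close>

primrec euler_from ::
  "(real \<Rightarrow> real \<Rightarrow> real) \<Rightarrow> (real \<Rightarrow> real \<Rightarrow> real) \<Rightarrow> (nat \<Rightarrow> real) \<Rightarrow> nat \<Rightarrow> real \<Rightarrow> (nat \<Rightarrow> real) \<Rightarrow> nat \<Rightarrow> real"
where
  "euler_from b \<sigma> T k x e 0 = x"
| "euler_from b \<sigma> T k x e (Suc j) =
    euler_from b \<sigma> T k x e j
    + b (euler_from b \<sigma> T k x e j) (T (k + j)) * (T (Suc (k + j)) - T (k + j))
    + \<sigma> (euler_from b \<sigma> T k x e j) (T (k + j)) * e (k + j)"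

lemma euler_from_cong:
  "(\<And>i. k \<le> i \<Longrightarrow> i < k + j \<Longrightarrow> e i = e' i) \<Longrightarrow> euler_from b \<sigma> T k x e j = euler_from b \<sigma> T k x e' j"
  by (induction j) auto

lemma euler_from_add:
  "euler_from b \<sigma> T k x e (i + j) = euler_from b \<sigma> T (k + i) (euler_from b \<sigma> T k x e i) e j"
  by (induction j) (auto simp: add.assoc)

primrec observe ::
  "(real \<Rightarrow> real \<Rightarrow> real \<Rightarrow> real) \<Rightarrow> (real \<Rightarrow> real \<Rightarrow> real) \<Rightarrow> (real \<Rightarrow> real \<Rightarrow> real) \<Rightarrow> real \<Rightarrow>
   (nat \<Rightarrow> real) \<Rightarrow> (nat \<Rightarrow> real) \<Rightarrow> (nat \<Rightarrow> real) \<Rightarrow> (nat \<Rightarrow> real) \<Rightarrow> nat \<Rightarrow> real"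
where
  "observe h \<nu> \<delta> y0 T x e e' 0 = y0"
| "observe h \<nu> \<delta> y0 T x e e' (Suc k) =
    observe h \<nu> \<delta> y0 T x e e' k
    + h (observe h \<nu> \<delta> y0 T x e e' k) (x k) (T k) * (T (Suc k) - T k)
    + \<nu> (observe h \<nu> \<delta> y0 T x e e' k) (T k) * e k
    + \<delta> (observe h \<nu> \<delta> y0 T x e e' k) (T k) * e' k"

lemma observe_cong:
  "(\<And>i. i < k \<Longrightarrow> x i = x2 i \<and> e i = e2 i \<and> e' i = e2' i) \<Longrightarrow>
    observe h \<nu> \<delta> y0 T x e e' k = observe h \<nu> \<delta> y0 T x2 e2 e2' k"
  by (induction k) auto

text \<open>The index of the sample at the right end of an interval: level \<open>0\<close>, grid point \<open>1\<close>.\<close>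

definition endpoint :: "nat \<times> nat" where
  "endpoint = (0, 1)"

text \<open>A state below \<open>a\<close> makes the factor \<open>G\<close> and the survival indicator vanish alike; from \<open>a\<close> upwards
the volatility is positive, and the next piece of the scheme is a rescaled Brownian path.\<close>

locale euler_barrier =
  fixes M :: "'a measure" and W W' :: "real \<Rightarrow> 'a \<Rightarrow> real"
    and b \<sigma> \<nu> \<delta> :: "real \<Rightarrow> real \<Rightarrow> real" and h :: "real \<Rightarrow> real \<Rightarrow> real \<Rightarrow> real"
    and x0 y0 a :: real and m n :: nat and T :: "nat \<Rightarrow> real"
  assumes BM: "brownian_motion M W" and WW': "indep_processes M W W'"
    and T0: "T 0 = 0" and T_mono: "strict_mono_on {..n} T" and mn: "m < n"
    and meas_b: "\<And>u. 0 \<le> u \<Longrightarrow> (\<lambda>x. b x u) \<in> borel_measurable borel"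
    and meas_\<sigma>: "\<And>u. 0 \<le> u \<Longrightarrow> (\<lambda>x. \<sigma> x u) \<in> borel_measurable borel"
    and meas_h: "\<And>u. 0 \<le> u \<Longrightarrow> (\<lambda>p. h (fst p) (snd p) u) \<in> borel_measurable borel"
    and meas_\<nu>: "\<And>u. 0 \<le> u \<Longrightarrow> (\<lambda>y. \<nu> y u) \<in> borel_measurable borel"
    and meas_\<delta>: "\<And>u. 0 \<le> u \<Longrightarrow> (\<lambda>y. \<delta> y u) \<in> borel_measurable borel"
    and \<sigma>_pos: "\<And>x u. a \<le> x \<Longrightarrow> 0 \<le> u \<Longrightarrow> 0 < \<sigma> x u"
begin

sublocale prob_space M by (rule brownian_motionD(1)[OF BM])

abbreviation "X \<equiv> euler b \<sigma> x0 T n W"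
abbreviation "Y \<equiv> observation h \<nu> \<delta> y0 T X W W'"
abbreviation "G \<equiv> survival_factor a \<sigma> T"
abbreviation "paths \<equiv> PiM UNIV (\<lambda>_. borel) :: (nat \<times> nat \<Rightarrow> real) measure"

text \<open>The independent sources of randomness: for \<open>k < n\<close> the piece of \<open>W\<close> over the \<open>k\<close>-th interval,
and at index \<open>n\<close> the values of the second Brownian motion at the grid times, stored in the same
product space with an idle first index.\<close>

definition source :: "nat \<Rightarrow> 'a \<Rightarrow> nat \<times> nat \<Rightarrow> real" where
  "source k = (if k < n then path_samples W (T k) (T (Suc k)) else (\<lambda>\<omega> (N, i). W' (T (min i n)) \<omega>))"

definition noise :: "'a \<Rightarrow> nat \<Rightarrow> nat \<times> nat \<Rightarrow> real" where
  "noise \<omega> = (\<lambda>k\<in>{..n}. source k \<omega>)"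

definition state :: "(nat \<Rightarrow> nat \<times> nat \<Rightarrow> real) \<Rightarrow> nat \<Rightarrow> real" where
  "state v = euler_from b \<sigma> T 0 x0 (\<lambda>k. v k endpoint)"

definition obs :: "(nat \<Rightarrow> nat \<times> nat \<Rightarrow> real) \<Rightarrow> nat \<Rightarrow> real" where
  "obs v = observe h \<nu> \<delta> y0 T (state v) (\<lambda>k. v k endpoint) (\<lambda>k. v n (0, Suc k) - v n (0, k))"

text \<open>Survival over the \<open>k\<close>-th interval from state \<open>x\<close>, written through the dyadic samples \<open>w\<close> of the
driving path in the form supplied by \<open>above_iff_dyadic\<close>.\<close>

definition stays_above :: "nat \<Rightarrow> real \<Rightarrow> (nat \<times> nat \<Rightarrow> real) \<Rightarrow> bool" where
  "stays_above k x w \<longleftrightarrow> (\<exists>r. \<forall>N i. i \<le> 2 ^ N \<longrightarrow> a + inverse (real (Suc r)) <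
     x + b x (T k) * (dyadic (T k) (T (Suc k)) N i - T k) + \<sigma> x (T k) * w (N, i))"

lemma T_nonneg: "k \<le> n \<Longrightarrow> 0 \<le> T k"
  using strict_mono_on_leD[OF T_mono, of 0 k] T0 by simp

lemma T_step: "k < n \<Longrightarrow> T k < T (Suc k)"
  using strict_mono_onD[OF T_mono, of k "Suc k"] by simp

lemma indep_source: "indep_vars (\<lambda>_. paths) source {..n}"
  using indep_path_samples[OF BM WW' T_mono] T0 by (simp add: source_def[abs_def])

lemma source_measurable [measurable]: "k \<le> n \<Longrightarrow> source k \<in> measurable M paths"
  using indep_source by (simp add: indep_vars_def)

lemma noise_measurable [measurable]: "noise \<in> measurable M (PiM {..n} (\<lambda>_. paths))"
  unfolding noise_def[abs_def] by (rule measurable_restrict) simp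

lemma noise_apply: "k \<le> n \<Longrightarrow> noise \<omega> k = source k \<omega>"
  by (simp add: noise_def)

lemma source_end: "k < n \<Longrightarrow> source k \<omega> endpoint = W (T (Suc k)) \<omega> - W (T k) \<omega>"
  using dyadic_end[of "T k" "T (Suc k)" 0] by (simp add: source_def path_samples_def endpoint_def)

lemma X_eq_state: "k \<le> n \<Longrightarrow> X (T k) \<omega> = state (noise \<omega>) k"
proof (induction k)
  case 0
  then show ?case using euler_at_0[OF T_mono] mn by (simp add: state_def)
next
  case (Suc k)
  then show ?case
    using euler_step[OF T_mono, of k "T (Suc k)" b \<sigma> x0 W \<omega>] T_step[of k]
    by (simp add: state_def noise_apply source_end)
qed

lemma Y_eq_obs: "k \<le> n \<Longrightarrow> Y k \<omega> = obs (noise \<omega>) k"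
proof (induction k)
  case (Suc k)
  then show ?case
    by (simp add: obs_def noise_apply source_end X_eq_state Let_def) (simp add: source_def min_def)
qed (simp add: obs_def)

lemma euler_from_measurable:
  assumes x: "x \<in> borel_measurable Q" and kj: "k + j \<le> n"
    and e: "\<And>i. k \<le> i \<Longrightarrow> i < k + j \<Longrightarrow> (\<lambda>q. e q i) \<in> borel_measurable Q"
  shows "(\<lambda>q. euler_from b \<sigma> T k (x q) (e q) j) \<in> borel_measurable Q"
  using kj e
proof (induction j)
  case (Suc j)
  have [measurable]: "(\<lambda>q. euler_from b \<sigma> T k (x q) (e q) j) \<in> borel_measurable Q"
    using Suc by simp
  have [measurable]: "(\<lambda>q. e q (k + j)) \<in> borel_measurable Q" using Suc.prems by simp
  have "0 \<le> T (k + j)" using Suc.prems by (simp add: T_nonneg)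
  note [measurable] = meas_b[OF this] meas_\<sigma>[OF this]
  show ?case unfolding euler_from.simps by measurable
qed (simp add: x)

lemma component_measurable:
  "k \<in> I \<Longrightarrow> (\<lambda>v. v k c) \<in> borel_measurable (PiM I (\<lambda>_. paths))"
  by (rule measurable_compose[where g = "\<lambda>w. w c" and N = paths]) auto

lemma state_measurable: "{..<k} \<subseteq> I \<Longrightarrow> k \<le> n \<Longrightarrow> (\<lambda>v. state v k) \<in> borel_measurable (PiM I (\<lambda>_. paths))"
  unfolding state_def by (intro euler_from_measurable component_measurable) auto

lemma obs_measurable:
  "{..<k} \<subseteq> I \<Longrightarrow> n \<in> I \<Longrightarrow> k \<le> n \<Longrightarrow> (\<lambda>v. obs v k) \<in> borel_measurable (PiM I (\<lambda>_. paths))"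
proof (induction k)
  case (Suc k)
  have [measurable]: "(\<lambda>v. obs v k) \<in> borel_measurable (PiM I (\<lambda>_. paths))"
    using Suc by (simp add: lessThan_Suc)
  have [measurable]: "(\<lambda>v. state v k) \<in> borel_measurable (PiM I (\<lambda>_. paths))"
    using Suc.prems by (intro state_measurable) auto
  have [measurable]: "(\<lambda>v. v k endpoint) \<in> borel_measurable (PiM I (\<lambda>_. paths))"
    "(\<lambda>v. v n (0, i)) \<in> borel_measurable (PiM I (\<lambda>_. paths))" for i
    using Suc.prems by (auto intro: component_measurable)
  have Tk: "0 \<le> T k" using Suc.prems by (simp add: T_nonneg)
  note [measurable] = meas_\<nu>[OF Tk] meas_\<delta>[OF Tk]
  have [measurable]: "(\<lambda>v. h (obs v k) (state v k) (T k)) \<in> borel_measurable (PiM I (\<lambda>_. paths))"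
    using measurable_compose[OF borel_measurable_Pair meas_h[OF Tk], of "\<lambda>v. obs v k" _ "\<lambda>v. state v k"] by simp
  have "(\<lambda>v. obs v (Suc k)) = (\<lambda>v. obs v k + h (obs v k) (state v k) (T k) * (T (Suc k) - T k)
      + \<nu> (obs v k) (T k) * v k endpoint + \<delta> (obs v k) (T k) * (v n (0, Suc k) - v n (0, k)))"
    by (simp add: obs_def fun_eq_iff)
  then show ?case by simp
qed (simp add: obs_def)

lemma state_cong: "(\<And>j. j < k \<Longrightarrow> v j endpoint = w j endpoint) \<Longrightarrow> state v k = state w k"
  unfolding state_def by (rule euler_from_cong) auto

lemma obs_cong: "(\<And>j. j < k \<Longrightarrow> v j endpoint = w j endpoint) \<Longrightarrow> v n = w n \<Longrightarrow> obs v k = obs w k"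
  unfolding obs_def by (rule observe_cong) (auto intro!: state_cong)

lemma stays_above_measurable:
  assumes k: "k < n" and x [measurable]: "x \<in> borel_measurable Q" and w: "w \<in> measurable Q paths"
  shows "Measurable.pred Q (\<lambda>q. stays_above k (x q) (w q))"
proof -
  have "0 \<le> T k" using k by (simp add: T_nonneg)
  note [measurable] = meas_b[OF this] meas_\<sigma>[OF this]
  have [measurable]: "(\<lambda>q. w q c) \<in> borel_measurable Q" for c
    by (rule measurable_compose[OF w measurable_component_singleton]) simp
  show ?thesis unfolding stays_above_def by measurable
qed

lemma stays_above_iff:
  assumes k: "k < n" and \<omega>: "\<omega> \<in> space M"
  shows "stays_above k x (source k \<omega>) \<longleftrightarrow>
    (\<forall>u\<in>{T k..T (Suc k)}. a < x + b x (T k) * (u - T k) + \<sigma> x (T k) * (W u \<omega> - W (T k) \<omega>))"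
proof -
  have "continuous_on {T k..T (Suc k)} (\<lambda>u. W u \<omega>)"
    using T_nonneg[of k] k by (intro continuous_on_subset[OF brownian_motionD(4)[OF BM \<omega>]]) auto
  then have "continuous_on {T k..T (Suc k)}
      (\<lambda>u. x + b x (T k) * (u - T k) + \<sigma> x (T k) * (W u \<omega> - W (T k) \<omega>))"
    by (intro continuous_intros)
  from above_iff_dyadic[OF T_step[OF k] this, of a]
  show ?thesis unfolding stays_above_def using k by (simp add: source_def path_samples_def min_def)
qed

lemma survival_on_interval:
  assumes k: "k < n" and \<omega>: "\<omega> \<in> space M"
  shows "(\<forall>u\<in>{T k..T (Suc k)}. a < X u \<omega>) \<longleftrightarrow> stays_above k (state (noise \<omega>) k) (noise \<omega> k)"
proof -
  have "X u \<omega> = X (T k) \<omega> + b (X (T k) \<omega>) (T k) * (u - T k) + \<sigma> (X (T k) \<omega>) (T k) * (W u \<omega> - W (T k) \<omega>)"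
    if "u \<in> {T k..T (Suc k)}" for u
    using euler_step[OF T_mono k, of u] that by simp
  note step = this
  have "(\<forall>u\<in>{T k..T (Suc k)}. a < X u \<omega>) \<longleftrightarrow> stays_above k (X (T k) \<omega>) (source k \<omega>)"
    unfolding stays_above_iff[OF k \<omega>] by (rule ball_cong[OF refl], subst step, assumption, rule refl)
  then show ?thesis using k by (simp add: X_eq_state noise_apply)
qed

lemma G_range: "k < n \<Longrightarrow> 0 \<le> G k x x'" "k < n \<Longrightarrow> G k x x' \<le> 1"
  using T_step[of k] by (auto simp: survival_factor_def)

lemma G_measurable:
  assumes k: "k < n" and [measurable]: "x \<in> borel_measurable Q" "x' \<in> borel_measurable Q"
  shows "(\<lambda>q. G k (x q) (x' q)) \<in> borel_measurable Q"
proof -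
  have "0 \<le> T k" using k by (simp add: T_nonneg)
  note [measurable] = meas_\<sigma>[OF this]
  show ?thesis unfolding survival_factor_def by measurable
qed

text \<open>Freeze all pieces except the \<open>k\<close>-th. The state at \<open>t_k\<close> is then fixed, and by \<open>q_end\<close> the
remaining factor sees the \<open>k\<close>-th piece only through its end increment, so it may be taken as the
test function in the bridge formula. It is allowed to depend on later pieces as well, which is
why the intervals can be treated in any order.\<close>

lemma replace_survival:
  fixes q :: "(nat \<Rightarrow> nat \<times> nat \<Rightarrow> real) \<Rightarrow> ennreal"
  assumes k: "k < n" and q: "q \<in> borel_measurable (PiM {..n} (\<lambda>_. paths))" and q1: "\<And>v. q v \<le> 1"
    and q_end: "\<And>v w. (\<And>j. j \<noteq> k \<Longrightarrow> v j = w j) \<Longrightarrow> v k endpoint = w k endpoint \<Longrightarrow> q v = q w"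
  shows "(\<integral>\<^sup>+\<omega>. of_bool (stays_above k (state (noise \<omega>) k) (noise \<omega> k)) * q (noise \<omega>) \<partial>M)
    = (\<integral>\<^sup>+\<omega>. ennreal (G k (state (noise \<omega>) k) (state (noise \<omega>) (Suc k))) * q (noise \<omega>) \<partial>M)"
proof -
  let ?U = "\<lambda>\<omega>. \<lambda>j\<in>{..n} - {k}. source j \<omega>" and ?w = "\<lambda>\<omega>. \<lambda>j\<in>{k}. source j \<omega>"
  let ?N1 = "PiM ({..n} - {k}) (\<lambda>_. paths)" and ?N2 = "PiM {k} (\<lambda>_. paths)"
  have ind: "indep_var ?N1 ?U ?N2 ?w"
    using k by (intro indep_var_restrict[OF indep_source]) auto
  \<comment> \<open>By \<open>q_end\<close> the \<open>k\<close>-th piece may be replaced by any path with the right end increment, such as a constant one.\<close>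
  define p where "p z y = q (z(k := (\<lambda>_. y)))" for z y
  define x' where "x' x y = x + b x (T k) * (T (Suc k) - T k) + \<sigma> x (T k) * y" for x y
  have Tk: "0 \<le> T k" using k by (simp add: T_nonneg)
  note [measurable] = meas_b[OF Tk] meas_\<sigma>[OF Tk]
  have state_U: "state (noise \<omega>) k = state (?U \<omega>) k" for \<omega>
    using k by (intro state_cong) (simp add: noise_apply)
  have state_Suc: "state (noise \<omega>) (Suc k) = x' (state (?U \<omega>) k) (source k \<omega> endpoint)" for \<omega>
    using k unfolding state_U[symmetric] by (simp add: state_def x'_def noise_apply)
  have q_p: "q (noise \<omega>) = p (?U \<omega>) (source k \<omega> endpoint)" for \<omega>
    unfolding p_def using k by (intro q_end) (auto simp: noise_def)
  have xM [measurable]: "(\<lambda>z. state z k) \<in> borel_measurable ?N1"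
    using k by (intro state_measurable) auto
  have wM: "(\<lambda>w. w k) \<in> measurable ?N2 paths" by (rule measurable_component_singleton) simp
  have wcM [measurable]: "(\<lambda>w. w k c) \<in> borel_measurable ?N2" for c by (rule component_measurable) simp
  have const: "(\<lambda>y. (\<lambda>_. y)) \<in> measurable borel paths"
    by (rule measurable_PiM_single') auto
  have upd: "(\<lambda>(z, y). z(k := (\<lambda>_. y))) \<in> measurable (?N1 \<Otimes>\<^sub>M borel) (PiM {..n} (\<lambda>_. paths))"
    unfolding case_prod_beta
    by (rule measurable_fun_upd[where J = "{..n} - {k}"])
       (use k in \<open>auto intro: measurable_compose[OF measurable_snd const]\<close>)
  have pM [measurable]: "(\<lambda>zy. p (fst zy) (snd zy)) \<in> borel_measurable (?N1 \<Otimes>\<^sub>M borel)"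
    unfolding p_def using measurable_compose[OF upd q] by (simp add: case_prod_beta)
  have pM2 [measurable]: "(\<lambda>zw. p (fst zw) (snd zw k endpoint)) \<in> borel_measurable (?N1 \<Otimes>\<^sub>M ?N2)"
    using measurable_compose[OF _ pM, of "\<lambda>zw. (fst zw, snd zw k endpoint)" "?N1 \<Otimes>\<^sub>M ?N2"] by simp
  have [measurable]: "(\<lambda>zw. ennreal (G k (state (fst zw) k) (x' (state (fst zw) k) (snd zw k endpoint))))
      \<in> borel_measurable (?N1 \<Otimes>\<^sub>M ?N2)"
  proof -
    have [measurable]: "(\<lambda>zw. G k (state (fst zw) k) (x' (state (fst zw) k) (snd zw k endpoint)))
      \<in> borel_measurable (?N1 \<Otimes>\<^sub>M ?N2)"
      unfolding x'_def by (rule G_measurable[OF k]) measurable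
    show ?thesis by measurable
  qed
  have [measurable]: "Measurable.pred (?N1 \<Otimes>\<^sub>M ?N2) (\<lambda>zw. stays_above k (state (fst zw) k) (snd zw k))"
    by (rule stays_above_measurable[OF k])
       (rule measurable_compose[OF measurable_fst xM], rule measurable_compose[OF measurable_snd wM])
  have inner: "(\<integral>\<^sup>+\<omega>'. of_bool (stays_above k x (source k \<omega>')) * p z (source k \<omega>' endpoint) \<partial>M)
      = (\<integral>\<^sup>+\<omega>'. ennreal (G k x (x' x (source k \<omega>' endpoint))) * p z (source k \<omega>' endpoint) \<partial>M)"
    if z: "z \<in> space ?N1" for z x
  proof -
    have [measurable]: "p z \<in> borel_measurable borel"
      using measurable_compose[OF measurable_Pair1'[OF z] pM] by simp
    have p1: "p z y \<le> 1" for y by (simp add: p_def q1)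
    have "(\<integral>\<^sup>+\<omega>'. of_bool (stays_above k x (source k \<omega>')) * p z (source k \<omega>' endpoint) \<partial>M)
      = (\<integral>\<^sup>+\<omega>'. of_bool (\<forall>u\<in>{T k..T (Suc k)}. a < x + b x (T k) * (u - T k)
            + \<sigma> x (T k) * (W u \<omega>' - W (T k) \<omega>')) * p z (W (T (Suc k)) \<omega>' - W (T k) \<omega>') \<partial>M)"
      by (intro nn_integral_cong) (simp add: stays_above_iff[OF k] source_end[OF k])
    also have "\<dots> = (\<integral>\<^sup>+\<omega>'. ennreal (G k x (x' x (source k \<omega>' endpoint))) * p z (source k \<omega>' endpoint) \<partial>M)"
      unfolding source_end[OF k] survival_factor_def x'_def
      by (rule brownian_bridge_survival[OF BM Tk T_step[OF k]])
         (use \<sigma>_pos Tk p1 in auto)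
    finally show ?thesis .
  qed
  have "?U \<in> measurable M ?N1" using ind by (simp add: indep_var_distribution_eq)
  from measurable_space[OF this] have U_space: "?U \<omega> \<in> space ?N1" if "\<omega> \<in> space M" for \<omega>
    using that by blast
  have "(\<integral>\<^sup>+\<omega>. of_bool (stays_above k (state (noise \<omega>) k) (noise \<omega> k)) * q (noise \<omega>) \<partial>M)
     = (\<integral>\<^sup>+\<omega>. (\<lambda>z w. of_bool (stays_above k (state z k) (w k)) * p z (w k endpoint)) (?U \<omega>) (?w \<omega>) \<partial>M)"
    using k by (simp add: state_U q_p noise_apply)
  also have "\<dots> = (\<integral>\<^sup>+\<omega>. \<integral>\<^sup>+\<omega>'. (\<lambda>z w. of_bool (stays_above k (state z k) (w k)) * p z (w k endpoint)) (?U \<omega>) (?w \<omega>') \<partial>M \<partial>M)"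
    by (rule nn_integral_indep_var[OF ind]) measurable
  also have "\<dots> = (\<integral>\<^sup>+\<omega>. \<integral>\<^sup>+\<omega>'. (\<lambda>z w. ennreal (G k (state z k) (x' (state z k) (w k endpoint))) * p z (w k endpoint)) (?U \<omega>) (?w \<omega>') \<partial>M \<partial>M)"
    by (rule nn_integral_cong) (use inner[OF U_space] in simp)
  also have "\<dots> = (\<integral>\<^sup>+\<omega>. (\<lambda>z w. ennreal (G k (state z k) (x' (state z k) (w k endpoint))) * p z (w k endpoint)) (?U \<omega>) (?w \<omega>) \<partial>M)"
    by (rule nn_integral_indep_var[OF ind, symmetric]) measurable
  also have "\<dots> = (\<integral>\<^sup>+\<omega>. ennreal (G k (state (noise \<omega>) k) (state (noise \<omega>) (Suc k))) * q (noise \<omega>) \<partial>M)"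
    unfolding state_Suc q_p state_U by simp
  finally show ?thesis .
qed

end

section \<open>Survival probabilities given the observations\<close>

lemma prod_le_1_ennreal: "(\<And>i. i \<in> A \<Longrightarrow> f i \<le> (1::ennreal)) \<Longrightarrow> prod f A \<le> 1"
proof (induction A rule: infinite_finite_induct)
  case (insert i A)
  then show ?case using mult_mono[of "f i" 1 "prod f A" 1] by simp
qed auto

context euler_barrier
begin

text \<open>The intervals are converted from the last to the first. While interval \<open>j\<close> is treated, the
earlier ones still carry survival indicators, which do not involve the \<open>j\<close>-th piece, and the
later ones already carry factors \<open>G\<close>, which see it only through its end increment.\<close>

lemma replace_all_survival:
  fixes q :: "(nat \<Rightarrow> nat \<times> nat \<Rightarrow> real) \<Rightarrow> ennreal"
  assumes q: "q \<in> borel_measurable (PiM {..n} (\<lambda>_. paths))" and q1: "\<And>v. q v \<le> 1"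
    and q_end: "\<And>v w. (\<And>j. j < n \<Longrightarrow> v j endpoint = w j endpoint) \<Longrightarrow> v n = w n \<Longrightarrow> q v = q w"
  shows "(\<integral>\<^sup>+\<omega>. q (noise \<omega>) * (\<Prod>k<n. of_bool (stays_above k (state (noise \<omega>) k) (noise \<omega> k))) \<partial>M)
    = (\<integral>\<^sup>+\<omega>. q (noise \<omega>) * (\<Prod>k<n. ennreal (G k (state (noise \<omega>) k) (state (noise \<omega>) (Suc k)))) \<partial>M)"
proof -
  define A where "A k v = (of_bool (stays_above k (state v k) (v k)) :: ennreal)" for k v
  define g where "g k v = ennreal (G k (state v k) (state v (Suc k)))" for k v
  have stateM: "(\<lambda>v. state v k) \<in> borel_measurable (PiM {..n} (\<lambda>_. paths))" if "k \<le> n" for k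
    using that by (intro state_measurable) auto
  have AM: "A k \<in> borel_measurable (PiM {..n} (\<lambda>_. paths))" if "k < n" for k
  proof -
    have [measurable]: "Measurable.pred (PiM {..n} (\<lambda>_. paths)) (\<lambda>v. stays_above k (state v k) (v k))"
      using that by (intro stays_above_measurable stateM measurable_component_singleton) auto
    show ?thesis unfolding A_def[abs_def] by measurable
  qed
  have gM: "g k \<in> borel_measurable (PiM {..n} (\<lambda>_. paths))" if "k < n" for k
    unfolding g_def[abs_def] using that
    by (intro measurable_compose[OF _ measurable_ennreal] G_measurable stateM) auto
  have A1: "A k v \<le> 1" for k v by (simp add: A_def)
  have g1: "g k v \<le> 1" if "k < n" for k v
    using G_range(2)[OF that] unfolding g_def by (metis ennreal_1 ennreal_leI)
  have "(\<integral>\<^sup>+\<omega>. q (noise \<omega>) * ((\<Prod>k<j. A k (noise \<omega>)) * (\<Prod>k=j..<n. g k (noise \<omega>))) \<partial>M)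
      = (\<integral>\<^sup>+\<omega>. q (noise \<omega>) * (\<Prod>k<n. g k (noise \<omega>)) \<partial>M)" if "j \<le> n" for j
    using that
  proof (induction j)
    case 0
    then show ?case by (simp add: atLeast0LessThan)
  next
    case (Suc j)
    then have j: "j < n" by simp
    define q' where "q' v = q v * ((\<Prod>k<j. A k v) * (\<Prod>k=Suc j..<n. g k v))" for v
    have q'M: "q' \<in> borel_measurable (PiM {..n} (\<lambda>_. paths))"
      unfolding q'_def[abs_def] using j
      by (intro borel_measurable_times_ennreal borel_measurable_prod_ennreal q AM gM) auto
    have q'1: "q' v \<le> 1" for v
    proof -
      have "(\<Prod>k<j. A k v) \<le> 1" "(\<Prod>k=Suc j..<n. g k v) \<le> 1"
        using A1 g1 by (auto intro!: prod_le_1_ennreal)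
      then have "q v * ((\<Prod>k<j. A k v) * (\<Prod>k=Suc j..<n. g k v)) \<le> 1 * (1 * 1)"
        by (intro mult_mono q1) auto
      then show ?thesis by (simp add: q'_def)
    qed
    have q'_end: "q' v = q' w" if "\<And>i. i \<noteq> j \<Longrightarrow> v i = w i" "v j endpoint = w j endpoint" for v w
    proof -
      have "v i endpoint = w i endpoint" for i using that by (cases "i = j") auto
      then have state: "state v = state w" by (intro ext state_cong)
      have "q v = q w" using \<open>\<And>i. v i endpoint = w i endpoint\<close> that(1)[of n] j by (intro q_end) auto
      moreover have "(\<Prod>k<j. A k v) = (\<Prod>k<j. A k w)"
        using that(1) by (intro prod.cong) (auto simp: A_def state)
      ultimately show ?thesis by (simp add: q'_def g_def state)
    qed
    have "(\<integral>\<^sup>+\<omega>. q (noise \<omega>) * ((\<Prod>k<Suc j. A k (noise \<omega>)) * (\<Prod>k=Suc j..<n. g k (noise \<omega>))) \<partial>M)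
        = (\<integral>\<^sup>+\<omega>. of_bool (stays_above j (state (noise \<omega>) j) (noise \<omega> j)) * q' (noise \<omega>) \<partial>M)"
      by (simp add: q'_def A_def mult_ac)
    also have "\<dots> = (\<integral>\<^sup>+\<omega>. g j (noise \<omega>) * q' (noise \<omega>) \<partial>M)"
      unfolding g_def by (rule replace_survival[OF j q'M q'1 q'_end])
    also have "\<dots> = (\<integral>\<^sup>+\<omega>. q (noise \<omega>) * ((\<Prod>k<j. A k (noise \<omega>)) * (\<Prod>k=j..<n. g k (noise \<omega>))) \<partial>M)"
      using j by (simp add: q'_def prod.atLeast_Suc_lessThan mult_ac)
    finally show ?case using Suc by simp
  qed
  from this[of n] show ?thesis by (simp add: A_def g_def)
qed

text \<open>The product of the factors \<open>G\<close> from index \<open>m\<close> on, for a scheme that is in state \<open>x\<close> at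
\<open>t_m\<close>. Averaging it over the noise gives \<open>future_mean\<close>, a concrete version of the regression
function that the theorem calls \<open>Fbar\<close>.\<close>

definition future_survival :: "real \<Rightarrow> (nat \<Rightarrow> nat \<times> nat \<Rightarrow> real) \<Rightarrow> real" where
  "future_survival x w = (\<Prod>k=m..<n. G k (euler_from b \<sigma> T m x (\<lambda>j. w j endpoint) (k - m))
     (euler_from b \<sigma> T m x (\<lambda>j. w j endpoint) (Suc k - m)))"

definition future_mean :: "real \<Rightarrow> ennreal" where
  "future_mean x = (\<integral>\<^sup>+\<omega>. ennreal (future_survival x (noise \<omega>)) \<partial>M)"

lemma future_survival_eq: "(\<Prod>k=m..<n. G k (state v k) (state v (Suc k))) = future_survival (state v m) v"
  unfolding future_survival_def
proof (rule prod.cong)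
  fix k assume k: "k \<in> {m..<n}"
  have "state v i = euler_from b \<sigma> T m (state v m) (\<lambda>j. v j endpoint) (i - m)" if "m \<le> i" for i
    using that euler_from_add[of b \<sigma> T 0 x0 "\<lambda>j. v j endpoint" m "i - m"] by (simp add: state_def)
  from this[of k] this[of "Suc k"] k
  show "G k (state v k) (state v (Suc k)) = G k (euler_from b \<sigma> T m (state v m) (\<lambda>j. v j endpoint) (k - m))
     (euler_from b \<sigma> T m (state v m) (\<lambda>j. v j endpoint) (Suc k - m))" by simp
qed simp

lemma future_survival_range: "0 \<le> future_survival x w" "future_survival x w \<le> 1"
  unfolding future_survival_def by (auto intro!: prod_nonneg prod_le_1 simp: G_range)

lemma future_survival_cong: "(\<And>j. m \<le> j \<Longrightarrow> j < n \<Longrightarrow> v j = w j) \<Longrightarrow> future_survival x v = future_survival x w"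
  unfolding future_survival_def by (intro prod.cong refl arg_cong2[where f = "G _"] euler_from_cong) auto

lemma future_survival_measurable:
  assumes x: "x \<in> borel_measurable Q" and w: "\<And>j. m \<le> j \<Longrightarrow> j < n \<Longrightarrow> (\<lambda>q. w q j) \<in> measurable Q paths"
  shows "(\<lambda>q. future_survival (x q) (w q)) \<in> borel_measurable Q"
proof -
  have "(\<lambda>q. w q j endpoint) \<in> borel_measurable Q" if "m \<le> j" "j < n" for j
    by (rule measurable_compose[OF w[OF that] measurable_component_singleton]) simp
  then show ?thesis
    unfolding future_survival_def by (intro borel_measurable_prod G_measurable euler_from_measurable x) auto
qed

lemma future_mean_measurable [measurable]: "future_mean \<in> borel_measurable borel"
proof -
  have [measurable]: "(\<lambda>p. future_survival (fst p) (noise (snd p))) \<in> borel_measurable (borel \<Otimes>\<^sub>M M)"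
  proof (rule future_survival_measurable)
    fix j assume "j < n"
    then have "(\<lambda>\<omega>. noise \<omega> j) \<in> measurable M paths" by (simp add: noise_apply)
    then show "(\<lambda>p. noise (snd p) j) \<in> measurable (borel \<Otimes>\<^sub>M M) paths"
      by (rule measurable_compose[OF measurable_snd])
  qed simp
  show ?thesis unfolding future_mean_def[abs_def] by measurable
qed

lemma future_mean_le_1: "future_mean x \<le> 1"
proof -
  have "future_mean x \<le> (\<integral>\<^sup>+\<omega>. 1 \<partial>M)"
    unfolding future_mean_def
    by (intro nn_integral_mono) (metis ennreal_1 ennreal_leI future_survival_range(2))
  then show ?thesis by (simp add: emeasure_space_1)
qed

text \<open>The Markov property: the pieces from \<open>m\<close> on are independent of the earlier ones and of the
observation noise, so they can be integrated out with the state at \<open>t_m\<close> frozen.\<close>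

lemma markov_future:
  fixes q :: "(nat \<Rightarrow> nat \<times> nat \<Rightarrow> real) \<Rightarrow> ennreal"
  assumes q: "q \<in> borel_measurable (PiM ({..<m} \<union> {n}) (\<lambda>_. paths))"
    and q_cong: "\<And>v w. (\<And>j. j < m \<Longrightarrow> v j = w j) \<Longrightarrow> v n = w n \<Longrightarrow> q v = q w"
  shows "(\<integral>\<^sup>+\<omega>. q (noise \<omega>) * ennreal (future_survival (state (noise \<omega>) m) (noise \<omega>)) \<partial>M)
    = (\<integral>\<^sup>+\<omega>. q (noise \<omega>) * future_mean (state (noise \<omega>) m) \<partial>M)"
proof -
  let ?U = "\<lambda>\<omega>. \<lambda>j\<in>{..<m} \<union> {n}. source j \<omega>" and ?w = "\<lambda>\<omega>. \<lambda>j\<in>{m..<n}. source j \<omega>"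
  let ?N1 = "PiM ({..<m} \<union> {n}) (\<lambda>_. paths)" and ?N2 = "PiM {m..<n} (\<lambda>_. paths)"
  have ind: "indep_var ?N1 ?U ?N2 ?w"
    using mn by (intro indep_var_restrict[OF indep_source]) auto
  have q_U: "q (noise \<omega>) = q (?U \<omega>)" for \<omega>
    using mn by (intro q_cong) (auto simp: noise_apply)
  have state_U: "state (noise \<omega>) m = state (?U \<omega>) m" for \<omega>
    using mn by (intro state_cong) (simp add: noise_apply)
  have future_w: "future_survival x (noise \<omega>) = future_survival x (?w \<omega>)" for x \<omega>
    by (intro future_survival_cong) (simp add: noise_apply)
  have stateM [measurable]: "(\<lambda>z. state z m) \<in> borel_measurable ?N1"
    using mn by (intro state_measurable) auto
  have [measurable]: "(\<lambda>p. future_survival (state (fst p) m) (snd p)) \<in> borel_measurable (?N1 \<Otimes>\<^sub>M ?N2)"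
    by (rule future_survival_measurable)
       (rule measurable_compose[OF measurable_fst stateM],
        rule measurable_compose[OF measurable_snd measurable_component_singleton], simp)
  have tM: "(\<lambda>\<omega>. future_survival x (noise \<omega>)) \<in> borel_measurable M" for x
    by (rule future_survival_measurable) (auto simp: noise_apply)
  note q[measurable]
  have "(\<integral>\<^sup>+\<omega>. q (noise \<omega>) * ennreal (future_survival (state (noise \<omega>) m) (noise \<omega>)) \<partial>M)
    = (\<integral>\<^sup>+\<omega>. (\<lambda>z w. q z * ennreal (future_survival (state z m) w)) (?U \<omega>) (?w \<omega>) \<partial>M)"
    by (simp only: q_U state_U future_w)
  also have "\<dots> = (\<integral>\<^sup>+\<omega>. \<integral>\<^sup>+\<omega>'. (\<lambda>z w. q z * ennreal (future_survival (state z m) w)) (?U \<omega>) (?w \<omega>') \<partial>M \<partial>M)"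
    by (rule nn_integral_indep_var[OF ind]) measurable
  also have "\<dots> = (\<integral>\<^sup>+\<omega>. q (noise \<omega>) * future_mean (state (noise \<omega>) m) \<partial>M)"
    unfolding future_w[symmetric] future_mean_def q_U state_U
    by (rule nn_integral_cong, rule nn_integral_cmult, rule measurable_compose[OF tM measurable_ennreal])
  finally show ?thesis .
qed

lemma survival_given_state:
  assumes D: "D \<in> sets borel"
  shows "(\<integral>\<^sup>+\<omega>. indicator D (X (T m) \<omega>) *
      ennreal (\<Prod>k=m..<n. G k (X (T k) \<omega>) (X (T (Suc k)) \<omega>)) \<partial>M)
    = (\<integral>\<^sup>+\<omega>. indicator D (X (T m) \<omega>) * future_mean (X (T m) \<omega>) \<partial>M)"
proof -
  note D[measurable]
  have [measurable]: "(\<lambda>z. state z m) \<in> borel_measurable (PiM ({..<m} \<union> {n}) (\<lambda>_. paths))"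
    using mn by (intro state_measurable) auto
  have "(\<Prod>k=m..<n. G k (X (T k) \<omega>) (X (T (Suc k)) \<omega>)) = future_survival (state (noise \<omega>) m) (noise \<omega>)" for \<omega>
    unfolding future_survival_eq[symmetric] by (intro prod.cong) (auto simp: X_eq_state)
  moreover have cong: "(indicator D (state v m) :: ennreal) = indicator D (state w m)"
    if "\<And>j. j < m \<Longrightarrow> v j = w j" for v w
    using that by (intro arg_cong[OF state_cong]) simp
  have "(\<integral>\<^sup>+\<omega>. indicator D (state (noise \<omega>) m) * ennreal (future_survival (state (noise \<omega>) m) (noise \<omega>)) \<partial>M)
      = (\<integral>\<^sup>+\<omega>. indicator D (state (noise \<omega>) m) * future_mean (state (noise \<omega>) m) \<partial>M)"
    by (rule markov_future[where q = "\<lambda>v. indicator D (state v m)"]) (measurable, rule cong)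
  ultimately show ?thesis using mn by (simp add: X_eq_state)
qed

lemma survives_iff:
  assumes \<omega>: "\<omega> \<in> space M"
  shows "(\<forall>u\<in>{0..T n}. a < X u \<omega>) \<longleftrightarrow> (\<forall>k<n. stays_above k (state (noise \<omega>) k) (noise \<omega> k))"
proof -
  have cover: "\<exists>k<n. u \<in> {T k..T (Suc k)}" if "u \<in> {0..T n}" for u
  proof -
    have "\<exists>k<j. u \<in> {T k..T (Suc k)}" if "0 < j" "0 \<le> u" "u \<le> T j" for j
      using that
    proof (induction j)
      case (Suc j)
      show ?case
      proof (cases "0 < j \<and> u \<le> T j")
        case True
        then show ?thesis using Suc less_SucI by blast
      next
        case False
        then show ?thesis using Suc.prems T0 by (intro exI[of _ j]) (cases j, auto)
      qed
    qed simp
    then show ?thesis using that mn by auto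
  qed
  have "{T k..T (Suc k)} \<subseteq> {0..T n}" if "k < n" for k
    using that T_nonneg[of k] strict_mono_on_leD[OF T_mono, of "Suc k" n] by auto
  then have "(\<forall>u\<in>{0..T n}. a < X u \<omega>) \<longleftrightarrow> (\<forall>k<n. \<forall>u\<in>{T k..T (Suc k)}. a < X u \<omega>)"
    using cover by blast
  then show ?thesis using survival_on_interval[OF _ \<omega>] by simp
qed

lemma X_measurable: "k \<le> n \<Longrightarrow> X (T k) \<in> borel_measurable M"
  using measurable_compose[OF noise_measurable state_measurable[of k "{..n}"]] lessThan_subset_iff[of k n]
  by (subst X_eq_state[THEN ext]) (auto simp: less_imp_le subset_iff)

lemma Y_measurable: "k \<le> n \<Longrightarrow> Y k \<in> borel_measurable M"
  using measurable_compose[OF noise_measurable obs_measurable[of k "{..n}"]] lessThan_subset_iff[of k n]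
  by (subst Y_eq_obs[THEN ext]) (auto simp: less_imp_le subset_iff)

lemma survives_measurable: "Measurable.pred M (\<lambda>\<omega>. \<forall>u\<in>{0..T n}. a < X u \<omega>)"
proof -
  have [measurable]: "Measurable.pred M (\<lambda>\<omega>. stays_above k (state (noise \<omega>) k) (noise \<omega> k))" if "k \<in> {..<n}" for k
    using that
    by (intro stays_above_measurable measurable_compose[OF noise_measurable state_measurable])
       (auto simp: noise_apply)
  have "Measurable.pred M (\<lambda>\<omega>. \<forall>k\<in>{..<n}. stays_above k (state (noise \<omega>) k) (noise \<omega> k))"
    by measurable
  then show ?thesis
    by (subst measurable_cong[OF survives_iff]) (simp_all add: Ball_def)
qed

text \<open>The identity behind the theorem, tested on an event of the observations. The indicator of such
an event is a function of the end increments of the first \<open>m\<close> pieces and of the observation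
noise. This makes it an admissible test function both for the replacement of the survival
indicators and for the Markov property at \<open>t_m\<close>.\<close>

lemma survival_given_observations:
  assumes C: "C \<in> sets (PiM {..m} (\<lambda>_. borel))"
  shows "(\<integral>\<^sup>+\<omega>. indicator C (\<lambda>k\<in>{..m}. Y k \<omega>) * of_bool (\<forall>u\<in>{0..T n}. a < X u \<omega>) \<partial>M)
    = (\<integral>\<^sup>+\<omega>. indicator C (\<lambda>k\<in>{..m}. Y k \<omega>) *
        (ennreal (\<Prod>k<m. G k (X (T k) \<omega>) (X (T (Suc k)) \<omega>)) * future_mean (X (T m) \<omega>)) \<partial>M)"
proof -
  define q :: "(nat \<Rightarrow> nat \<times> nat \<Rightarrow> real) \<Rightarrow> ennreal" where "q v = indicator C (\<lambda>k\<in>{..m}. obs v k)" for v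
  have qM: "q \<in> borel_measurable (PiM I (\<lambda>_. paths))" if "{..<m} \<subseteq> I" "n \<in> I" for I
    unfolding q_def[abs_def]
  proof (rule measurable_compose[OF measurable_restrict borel_measurable_indicator[OF C]])
    fix k assume "k \<in> {..m}"
    then show "(\<lambda>v. obs v k) \<in> borel_measurable (PiM I (\<lambda>_. paths))"
      using that mn by (intro obs_measurable) auto
  qed
  have q_cong: "q v = q w" if "\<And>j. j < m \<Longrightarrow> v j endpoint = w j endpoint" "v n = w n" for v w
  proof -
    have "(\<lambda>k\<in>{..m}. obs v k) = (\<lambda>k\<in>{..m}. obs w k)"
      using that by (intro restrict_ext obs_cong) auto
    then show ?thesis by (simp add: q_def)
  qed
  have q_Y: "indicator C (\<lambda>k\<in>{..m}. Y k \<omega>) = q (noise \<omega>)" for \<omega>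
    using mn unfolding q_def by (intro arg_cong2[where f = indicator] refl restrict_ext Y_eq_obs) auto
  define q' where "q' v = q v * ennreal (\<Prod>k<m. G k (state v k) (state v (Suc k)))" for v
  have q'M: "q' \<in> borel_measurable (PiM ({..<m} \<union> {n}) (\<lambda>_. paths))"
    unfolding q'_def[abs_def] using mn
    by (intro borel_measurable_times_ennreal qM measurable_compose[OF _ measurable_ennreal]
        borel_measurable_prod G_measurable state_measurable) auto
  have q'_cong: "q' v = q' w" if "\<And>j. j < m \<Longrightarrow> v j = w j" "v n = w n" for v w
  proof -
    have "state v k = state w k" if "k \<le> m" for k
      using that \<open>\<And>j. j < m \<Longrightarrow> v j = w j\<close> by (intro state_cong) auto
    then have "(\<Prod>k<m. G k (state v k) (state v (Suc k))) = (\<Prod>k<m. G k (state w k) (state w (Suc k)))"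
      by (intro prod.cong) auto
    then show ?thesis using q_cong[of v w] that by (simp add: q'_def)
  qed
  have "(\<integral>\<^sup>+\<omega>. indicator C (\<lambda>k\<in>{..m}. Y k \<omega>) * of_bool (\<forall>u\<in>{0..T n}. a < X u \<omega>) \<partial>M)
     = (\<integral>\<^sup>+\<omega>. q (noise \<omega>) * (\<Prod>k<n. of_bool (stays_above k (state (noise \<omega>) k) (noise \<omega> k))) \<partial>M)"
  proof (intro nn_integral_cong)
    fix \<omega> assume \<omega>: "\<omega> \<in> space M"
    have "(of_bool (\<forall>k<j. P k) :: ennreal) = (\<Prod>k<j. of_bool (P k))" for P and j :: nat
      by (induction j) (auto simp: less_Suc_eq)
    then show "indicator C (\<lambda>k\<in>{..m}. Y k \<omega>) * of_bool (\<forall>u\<in>{0..T n}. a < X u \<omega>)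
        = q (noise \<omega>) * (\<Prod>k<n. of_bool (stays_above k (state (noise \<omega>) k) (noise \<omega> k)))"
      by (simp add: q_Y survives_iff[OF \<omega>])
  qed
  also have "\<dots> = (\<integral>\<^sup>+\<omega>. q (noise \<omega>) * (\<Prod>k<n. ennreal (G k (state (noise \<omega>) k) (state (noise \<omega>) (Suc k)))) \<partial>M)"
    using mn by (intro replace_all_survival qM q_cong) (auto simp: q_def indicator_def)
  also have "\<dots> = (\<integral>\<^sup>+\<omega>. q' (noise \<omega>) * ennreal (future_survival (state (noise \<omega>) m) (noise \<omega>)) \<partial>M)"
  proof (intro nn_integral_cong)
    fix \<omega>
    have "(\<Prod>k<n. ennreal (G k (state (noise \<omega>) k) (state (noise \<omega>) (Suc k))))
        = ennreal (\<Prod>k<n. G k (state (noise \<omega>) k) (state (noise \<omega>) (Suc k)))"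
      by (rule prod_ennreal) (simp add: G_range)
    also have "(\<Prod>k<n. G k (state (noise \<omega>) k) (state (noise \<omega>) (Suc k)))
        = (\<Prod>k<m. G k (state (noise \<omega>) k) (state (noise \<omega>) (Suc k))) * future_survival (state (noise \<omega>) m) (noise \<omega>)"
      unfolding future_survival_eq[symmetric] atLeast0LessThan[symmetric] using mn
      by (simp add: prod.atLeastLessThan_concat)
    finally show "q (noise \<omega>) * (\<Prod>k<n. ennreal (G k (state (noise \<omega>) k) (state (noise \<omega>) (Suc k))))
        = q' (noise \<omega>) * ennreal (future_survival (state (noise \<omega>) m) (noise \<omega>))"
      by (simp add: q'_def ennreal_mult'' future_survival_range mult.assoc)
  qed
  also have "\<dots> = (\<integral>\<^sup>+\<omega>. q' (noise \<omega>) * future_mean (state (noise \<omega>) m) \<partial>M)"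
    by (rule markov_future[OF q'M q'_cong])
  also have "\<dots> = (\<integral>\<^sup>+\<omega>. indicator C (\<lambda>k\<in>{..m}. Y k \<omega>) *
        (ennreal (\<Prod>k<m. G k (X (T k) \<omega>) (X (T (Suc k)) \<omega>)) * future_mean (X (T m) \<omega>)) \<partial>M)"
    using mn by (simp add: q'_def q_Y X_eq_state mult.assoc)
  finally show ?thesis .
qed

end

section \<open>The conditional survival probability\<close>

lemma lipschitz_section_measurable:
  fixes f :: "real \<Rightarrow> real \<Rightarrow> real"
  assumes "\<exists>L. L-lipschitz_on (UNIV \<times> {0..}) (\<lambda>(x, u). f x u)" and u: "0 \<le> u"
  shows "(\<lambda>x. f x u) \<in> borel_measurable borel"
proof -
  have "continuous_on (UNIV \<times> {0..}) (\<lambda>(x, u). f x u)"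
    using assms(1) lipschitz_on_continuous_on by blast
  moreover have "continuous_on UNIV (\<lambda>x :: real. (x, u))" by (intro continuous_intros)
  ultimately have "continuous_on UNIV (\<lambda>x. (\<lambda>(x, u). f x u) (x, u))"
    by (rule continuous_on_compose2) (use u in auto)
  then show ?thesis by (intro borel_measurable_continuous_onI) simp
qed

lemma lipschitz_section_measurable_pair:
  fixes f :: "real \<Rightarrow> real \<Rightarrow> real \<Rightarrow> real"
  assumes "\<exists>L. L-lipschitz_on (UNIV \<times> UNIV \<times> {0..}) (\<lambda>(y, x, u). f y x u)" and u: "0 \<le> u"
  shows "(\<lambda>p. f (fst p) (snd p) u) \<in> borel_measurable borel"
proof -
  have "continuous_on (UNIV \<times> UNIV \<times> {0..}) (\<lambda>(y, x, u). f y x u)"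
    using assms(1) lipschitz_on_continuous_on by blast
  moreover have "continuous_on UNIV (\<lambda>p :: real \<times> real. (fst p, snd p, u))"
    by (intro continuous_intros)
  ultimately have "continuous_on UNIV (\<lambda>p. (\<lambda>(y, x, u). f y x u) (fst p, snd p, u))"
    by (rule continuous_on_compose2) (use u in auto)
  then show ?thesis by (intro borel_measurable_continuous_onI) simp
qed

text \<open>The bounds make both functions integrable and let the comparison be made between integrals in
\<open>ennreal\<close>, where no integrability conditions arise.\<close>

lemma (in finite_measure_subalgebra) real_cond_exp_eqI:
  assumes [measurable]: "f \<in> borel_measurable M" "g \<in> borel_measurable M"
    and f: "\<And>x. 0 \<le> f x \<and> f x \<le> 1" and g: "\<And>x. 0 \<le> g x \<and> g x \<le> 1"
    and eq: "\<And>A. A \<in> sets F \<Longrightarrow>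
      (\<integral>\<^sup>+x. indicator A x * ennreal (f x) \<partial>M) = (\<integral>\<^sup>+x. indicator A x * ennreal (g x) \<partial>M)"
  shows "AE x in M. real_cond_exp M F f x = real_cond_exp M F g x"
proof (rule real_cond_exp_charact)
  show intf: "integrable M f" and "integrable M (real_cond_exp M F g)"
    using f g by (auto intro!: integrable_const_bound[of _ 1] real_cond_exp_int)
  have intg: "integrable M g" using g by (auto intro!: integrable_const_bound[of _ 1])
  fix A assume A: "A \<in> sets F"
  then have [measurable]: "A \<in> sets M" using subalg by (auto simp: subalgebra_def)
  have *: "(\<integral>x\<in>A. k x \<partial>M) = enn2real (\<integral>\<^sup>+x. indicator A x * ennreal (k x) \<partial>M)"
    if [measurable]: "k \<in> borel_measurable M" and k: "\<And>x. 0 \<le> k x" for k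
    unfolding set_lebesgue_integral_def
    by (subst integral_eq_nn_integral)
       (auto simp: k ennreal_mult' ennreal_indicator)
  have "(\<integral>x\<in>A. f x \<partial>M) = (\<integral>x\<in>A. g x \<partial>M)"
    using f g by (simp add: * eq[OF A])
  also have "\<dots> = (\<integral>x\<in>A. real_cond_exp M F g x \<partial>M)"
    by (rule real_cond_exp_intA[OF intg A])
  finally show "(\<integral>x\<in>A. f x \<partial>M) = (\<integral>x\<in>A. real_cond_exp M F g x \<partial>M)" .
qed simp

text \<open>A path that survives \<open>{0..t}\<close> has hitting time \<open>\<infinity>\<close> here, because the infimum is taken over times up
to \<open>t\<close>; every other path has a hit, and a hitting time, of at most \<open>t\<close>.\<close>

lemma hitting_time_gt_iff:
  "ereal t < hitting_time t a X \<omega> \<longleftrightarrow> (\<forall>u\<in>{0..t}. a < X u \<omega>)"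
proof
  assume *: "ereal t < hitting_time t a X \<omega>"
  show "\<forall>u\<in>{0..t}. a < X u \<omega>"
  proof (rule ccontr)
    assume "\<not> (\<forall>u\<in>{0..t}. a < X u \<omega>)"
    then obtain u where "u \<in> {0..t}" "X u \<omega> \<le> a" by (auto simp: not_less)
    then have "hitting_time t a X \<omega> \<le> ereal u" "ereal u \<le> ereal t"
      unfolding hitting_time_def by (auto intro: Inf_lower)
    then show False using * by (meson leD order_trans)
  qed
next
  assume "\<forall>u\<in>{0..t}. a < X u \<omega>"
  then have "{u \<in> {0..t}. X u \<omega> \<le> a} = {}" by (auto simp: not_le)
  then show "ereal t < hitting_time t a X \<omega>" by (simp only: hitting_time_def) (simp add: top_ereal_def)
qed

lemma finite_measure_subalgebra_sigma_gen:
  assumes "prob_space M" "Z \<in> measurable M N"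
  shows "finite_measure_subalgebra M (sigma_gen M N Z)"
proof -
  interpret prob_space M by fact
  show ?thesis
  proof
    show "subalgebra M (sigma_gen M N Z)"
      using measurable_sets[OF assms(2)] measurable_space[OF assms(2)]
      by (auto simp: subalgebra_def sigma_gen_def sets_vimage_algebra2)
  qed
qed

theorem theorem2p4:
  fixes M :: "'a measure"
    and W W' :: "real \<Rightarrow> 'a \<Rightarrow> real"
    and b \<sigma> \<nu> \<delta> :: "real \<Rightarrow> real \<Rightarrow> real"
    and h :: "real \<Rightarrow> real \<Rightarrow> real \<Rightarrow> real"
    and x0 y0 a s t :: real
    and m n :: nat
    and T :: "nat \<Rightarrow> real"
    and X :: "real \<Rightarrow> 'a \<Rightarrow> real"
    and Y :: "nat \<Rightarrow> 'a \<Rightarrow> real"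
    and G :: "nat \<Rightarrow> real \<Rightarrow> real \<Rightarrow> real"
    and Xm Ym :: "'a \<Rightarrow> nat \<Rightarrow> real"
    and Fbar :: "real \<Rightarrow> real"
    and \<Phi> \<Psi> :: "(nat \<Rightarrow> real) \<Rightarrow> real"
  assumes "brownian_motion M W" and "brownian_motion M W'"
    and "indep_processes M W W'"
    and "\<exists>L. L-lipschitz_on (UNIV \<times> {0..}) (\<lambda>(x, u). b x u)"
    and "\<exists>L. L-lipschitz_on (UNIV \<times> {0..}) (\<lambda>(x, u). \<sigma> x u)"
    and "\<exists>L. L-lipschitz_on (UNIV \<times> UNIV \<times> {0..}) (\<lambda>(y, x, u). h y x u)"
    and "\<exists>L. L-lipschitz_on (UNIV \<times> {0..}) (\<lambda>(y, u). \<nu> y u)"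
    and "\<exists>L. L-lipschitz_on (UNIV \<times> {0..}) (\<lambda>(y, u). \<delta> y u)"
    and "\<And>x u. x > 0 \<Longrightarrow> u \<ge> 0 \<Longrightarrow> \<sigma> x u > 0 \<and> \<nu> x u > 0 \<and> \<delta> x u > 0"
    and "0 < a" and "a < x0"
    and "0 < s" and "s < t" and "1 \<le> m" and "m < n"
    and T: "T = grid s t m n"
    and X: "X = euler b \<sigma> x0 T n W"
    and Y: "Y = observation h \<nu> \<delta> y0 T X W W'"
    and G: "G = survival_factor a \<sigma> T"
    and Xm: "Xm = (\<lambda>\<omega>. \<lambda>k\<in>{..m}. X (T k) \<omega>)"
    and Ym: "Ym = (\<lambda>\<omega>. \<lambda>k\<in>{..m}. Y k \<omega>)"
    and Fbar: "cond_exp_version M borel (X (T m))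
                 (\<lambda>\<omega>. \<Prod>k=m..<n. G k (X (T k) \<omega>) (X (T (Suc k)) \<omega>)) Fbar"
    and \<Phi>: "\<Phi> = (\<lambda>z. Fbar (z m) * (\<Prod>k=0..<m. G k (z k) (z (Suc k))))"
    and \<Psi>: "cond_exp_version M (PiM {..m} (\<lambda>_. borel)) Ym (\<lambda>\<omega>. \<Phi> (Xm \<omega>)) \<Psi>"
  shows "AE \<omega> in M.
           real_cond_exp M (sigma_gen M (PiM {..m} (\<lambda>_. borel)) Ym)
             (indicat_real {\<omega> \<in> space M. hitting_time t a X \<omega> > ereal (T n)}) \<omega>
           = \<Psi> (Ym \<omega>)"
proof -
  have T0: "T 0 = 0" and Tn: "T n = t"
    using assms(13,15) \<open>m < n\<close> by (auto simp: T grid_def)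
  have T_mono: "strict_mono_on {..n} T"
    unfolding T using assms by (intro strict_mono_on_grid)
  interpret E: euler_barrier M W W' b \<sigma> \<nu> \<delta> h x0 y0 a m n T
  proof
    show "brownian_motion M W" "indep_processes M W W'" "m < n" by fact+
    show "T 0 = 0" "strict_mono_on {..n} T" by fact+
    show "0 < \<sigma> x u" if "a \<le> x" "0 \<le> u" for x u using assms(9)[of x u] \<open>0 < a\<close> that by simp
  qed (intro lipschitz_section_measurable lipschitz_section_measurable_pair assms; assumption)+
  have X': "X = E.X" and Y': "Y = E.Y" and G': "G = E.G" using X Y G by simp_all
  let ?Q = "PiM {..m} (\<lambda>_. borel) :: (nat \<Rightarrow> real) measure"
  let ?F = "sigma_gen M ?Q Ym"
  have XM: "X (T k) \<in> borel_measurable M" if "k \<le> n" for k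
    unfolding X' by (rule E.X_measurable[OF that])
  have YmM: "Ym \<in> measurable M ?Q"
    unfolding Ym Y' using \<open>m < n\<close> by (intro measurable_restrict E.Y_measurable) auto
  have GM: "(\<lambda>\<omega>. G k (X (T k) \<omega>) (X (T (Suc k)) \<omega>)) \<in> borel_measurable M" if "k < n" for k
    unfolding G' using that by (intro E.G_measurable XM) auto
  note [measurable] = E.future_mean_measurable
  have [measurable]: "X (T m) \<in> borel_measurable M" using XM[of m] \<open>m < n\<close> by simp
  interpret F: finite_measure_subalgebra M ?F
    by (rule finite_measure_subalgebra_sigma_gen[OF E.prob_space_axioms YmM])
  interpret FX: finite_measure_subalgebra M "sigma_gen M borel (X (T m))"
    by (rule finite_measure_subalgebra_sigma_gen[OF E.prob_space_axioms]) simp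
  \<comment> \<open>\<open>Fbar\<close> is only some version of a conditional expectation; \<open>tail\<close> is the explicit one.\<close>
  define tail where "tail \<omega> = enn2real (E.future_mean (X (T m) \<omega>))" for \<omega>
  have tail: "ennreal (tail \<omega>) = E.future_mean (X (T m) \<omega>)" "0 \<le> tail \<omega>" "tail \<omega> \<le> 1" for \<omega>
  proof -
    have "E.future_mean (X (T m) \<omega>) < \<top>"
      using E.future_mean_le_1 by (metis ennreal_one_less_top order_le_less_trans)
    then show *: "ennreal (tail \<omega>) = E.future_mean (X (T m) \<omega>)" by (simp add: tail_def)
    show "0 \<le> tail \<omega>" by (simp add: tail_def)
    show "tail \<omega> \<le> 1"
      using E.future_mean_le_1[of "X (T m) \<omega>"] unfolding *[symmetric] by simp
  qed
  have tailM [measurable]: "tail \<in> borel_measurable M" unfolding tail_def[abs_def] by measurable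
  have headM [measurable]: "(\<lambda>\<omega>. \<Prod>k=0..<m. G k (X (T k) \<omega>) (X (T (Suc k)) \<omega>)) \<in> borel_measurable M"
    using \<open>m < n\<close> by (intro borel_measurable_prod GM) auto
  have G_prod: "0 \<le> (\<Prod>k\<in>I. G k (X (T k) \<omega>) (X (T (Suc k)) \<omega>))" "(\<Prod>k\<in>I. G k (X (T k) \<omega>) (X (T (Suc k)) \<omega>)) \<le> 1"
    if "I \<subseteq> {..<n}" for I \<omega>
    using that E.G_range unfolding G' by (auto intro!: prod_nonneg prod_le_1)

  have "AE \<omega> in M. real_cond_exp M (sigma_gen M borel (X (T m)))
      (\<lambda>\<omega>. \<Prod>k=m..<n. G k (X (T k) \<omega>) (X (T (Suc k)) \<omega>)) \<omega>
    = real_cond_exp M (sigma_gen M borel (X (T m))) tail \<omega>"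
  proof (rule FX.real_cond_exp_eqI)
    show "(\<lambda>\<omega>. \<Prod>k=m..<n. G k (X (T k) \<omega>) (X (T (Suc k)) \<omega>)) \<in> borel_measurable M"
      by (intro borel_measurable_prod GM) auto
    show "0 \<le> (\<Prod>k=m..<n. G k (X (T k) \<omega>) (X (T (Suc k)) \<omega>)) \<and>
        (\<Prod>k=m..<n. G k (X (T k) \<omega>) (X (T (Suc k)) \<omega>)) \<le> 1" for \<omega>
      using G_prod[of "{m..<n}" \<omega>] by (auto simp: subset_eq)
    fix A assume "A \<in> sets (sigma_gen M borel (X (T m)))"
    then obtain D where D: "D \<in> sets borel" "A = X (T m) -` D \<inter> space M"
      by (auto simp: sigma_gen_def sets_vimage_algebra2)
    have ind: "indicator A \<omega> = (indicator D (X (T m) \<omega>) :: ennreal)" if "\<omega> \<in> space M" for \<omega>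
      using that by (simp add: D(2) indicator_def)
    show "(\<integral>\<^sup>+\<omega>. indicator A \<omega> * ennreal (\<Prod>k=m..<n. G k (X (T k) \<omega>) (X (T (Suc k)) \<omega>)) \<partial>M)
        = (\<integral>\<^sup>+\<omega>. indicator A \<omega> * ennreal (tail \<omega>) \<partial>M)"
      using E.survival_given_state[OF D(1)]
      by (simp add: ind tail X' G' cong: nn_integral_cong_simp)
  qed (use tail in auto)
  moreover have "AE \<omega> in M. real_cond_exp M (sigma_gen M borel (X (T m))) tail \<omega> = tail \<omega>"
  proof (rule FX.real_cond_exp_F_meas)
    show "integrable M tail"
      using tail by (intro E.integrable_const_bound[of _ 1]) auto
    have "X (T m) \<in> measurable (sigma_gen M borel (X (T m))) borel"
      unfolding sigma_gen_def by (rule measurable_vimage_algebra1) simp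
    from measurable_compose[OF this, of "\<lambda>x. enn2real (E.future_mean x)"]
    show "tail \<in> borel_measurable (sigma_gen M borel (X (T m)))" by (simp add: tail_def[abs_def])
  qed
  moreover have "AE \<omega> in M. Fbar (X (T m) \<omega>) = real_cond_exp M (sigma_gen M borel (X (T m)))
      (\<lambda>\<omega>. \<Prod>k=m..<n. G k (X (T k) \<omega>) (X (T (Suc k)) \<omega>)) \<omega>"
    using Fbar by (simp add: cond_exp_version_def)
  ultimately have Fbar_tail: "AE \<omega> in M. Fbar (X (T m) \<omega>) = tail \<omega>"
    by eventually_elim simp

  \<comment> \<open>\<open>\<Phi>\<close> of the states, with \<open>Fbar\<close> replaced by the explicit version.\<close>
  define f where "f \<omega> = (\<Prod>k=0..<m. G k (X (T k) \<omega>) (X (T (Suc k)) \<omega>)) * tail \<omega>" for \<omega>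
  have fM [measurable]: "f \<in> borel_measurable M" unfolding f_def[abs_def] by measurable
  have \<Phi>_Xm: "\<Phi> (Xm \<omega>) = Fbar (X (T m) \<omega>) * (\<Prod>k=0..<m. G k (X (T k) \<omega>) (X (T (Suc k)) \<omega>))" for \<omega>
  proof -
    have "(\<Prod>k=0..<m. G k (Xm \<omega> k) (Xm \<omega> (Suc k))) = (\<Prod>k=0..<m. G k (X (T k) \<omega>) (X (T (Suc k)) \<omega>))"
      by (intro prod.cong) (auto simp: Xm)
    then show ?thesis by (simp add: \<Phi>) (simp add: Xm)
  qed
  have "AE \<omega> in M. real_cond_exp M ?F (\<lambda>\<omega>. \<Phi> (Xm \<omega>)) \<omega> = real_cond_exp M ?F f \<omega>"
  proof (rule F.real_cond_exp_cong)
    show "AE \<omega> in M. \<Phi> (Xm \<omega>) = f \<omega>"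
      using Fbar_tail by eventually_elim (simp add: \<Phi>_Xm f_def)
    have [measurable]: "Fbar \<in> borel_measurable borel" using Fbar by (simp add: cond_exp_version_def)
    show "(\<lambda>\<omega>. \<Phi> (Xm \<omega>)) \<in> borel_measurable M" unfolding \<Phi>_Xm by measurable
  qed simp
  moreover have "AE \<omega> in M. \<Psi> (Ym \<omega>) = real_cond_exp M ?F (\<lambda>\<omega>. \<Phi> (Xm \<omega>)) \<omega>"
    using \<Psi> by (simp add: cond_exp_version_def)
  moreover have "AE \<omega> in M. real_cond_exp M ?F
      (indicat_real {\<omega> \<in> space M. hitting_time t a X \<omega> > ereal (T n)}) \<omega> = real_cond_exp M ?F f \<omega>"
  proof (rule F.real_cond_exp_eqI)
    let ?S = "{\<omega> \<in> space M. hitting_time t a X \<omega> > ereal (T n)}"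
    have S: "?S = {\<omega> \<in> space M. \<forall>u\<in>{0..T n}. a < X u \<omega>}"
      by (simp add: Tn hitting_time_gt_iff)
    have "?S \<in> sets M"
      unfolding S unfolding X' using E.survives_measurable by (simp add: pred_def)
    then show "indicat_real ?S \<in> borel_measurable M" by simp
    show "0 \<le> f \<omega> \<and> f \<omega> \<le> 1" for \<omega>
      using G_prod[of "{0..<m}" \<omega>] tail(2,3)[of \<omega>] \<open>m < n\<close> by (auto simp: f_def mult_le_one subset_eq)
    fix A assume "A \<in> sets ?F"
    then obtain C where C: "C \<in> sets ?Q" "A = Ym -` C \<inter> space M"
      using measurable_space[OF YmM] by (auto simp: sigma_gen_def sets_vimage_algebra2)
    have "(\<integral>\<^sup>+\<omega>. indicator A \<omega> * ennreal (indicat_real ?S \<omega>) \<partial>M)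
      = (\<integral>\<^sup>+\<omega>. indicator C (\<lambda>k\<in>{..m}. Y k \<omega>) * of_bool (\<forall>u\<in>{0..T n}. a < X u \<omega>) \<partial>M)"
      unfolding S by (intro nn_integral_cong) (auto simp: C(2) Ym indicator_def)
    also have "\<dots> = (\<integral>\<^sup>+\<omega>. indicator C (\<lambda>k\<in>{..m}. Y k \<omega>) *
        (ennreal (\<Prod>k<m. G k (X (T k) \<omega>) (X (T (Suc k)) \<omega>)) * E.future_mean (X (T m) \<omega>)) \<partial>M)"
      unfolding X' Y' G' by (rule E.survival_given_observations[OF C(1)])
    also have "\<dots> = (\<integral>\<^sup>+\<omega>. indicator A \<omega> * ennreal (f \<omega>) \<partial>M)"
    proof (rule nn_integral_cong)
      fix \<omega> assume "\<omega> \<in> space M"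
      then have "indicator A \<omega> = (indicator C (\<lambda>k\<in>{..m}. Y k \<omega>) :: ennreal)"
        by (simp add: C(2) Ym indicator_def)
      then show "indicator C (\<lambda>k\<in>{..m}. Y k \<omega>) *
          (ennreal (\<Prod>k<m. G k (X (T k) \<omega>) (X (T (Suc k)) \<omega>)) * E.future_mean (X (T m) \<omega>))
        = indicator A \<omega> * ennreal (f \<omega>)"
        by (simp add: f_def ennreal_mult'' tail atLeast0LessThan)
    qed
    finally show "(\<integral>\<^sup>+\<omega>. indicator A \<omega> * ennreal (indicat_real ?S \<omega>) \<partial>M)
        = (\<integral>\<^sup>+\<omega>. indicator A \<omega> * ennreal (f \<omega>) \<partial>M)" .
  qed simp_all
  ultimately show ?thesis by eventually_elim simp
qed

end
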